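(* Let $G$ be a graph of order $n\geq 5$ with complement $\overline{G}$. If both $G$ and $\overline{G}$ are connected, then $tpc(G)+tpc(\overline{G})\leq n+2$, and equality holds if and only if $G\cong T(2,n-2)$ or $\overline{G}\cong T(2,n-2)$.
   Context: All graphs are simple, finite and undirected. A total-coloring of a graph $G$ assigns a color to every vertex and every edge of $G$ (with no properness requirement). A path $P$ in a total-colored graph is a total-proper path if (i) any two adjacent edges of $P$ have distinct colors; (ii) any two adjacent internal vertices of $P$ have distinct colors; (iii) any internal vertex of $P$ has a color distinct from the colors of its incident edges of $P$. The total-colored graph $G$ is total-proper connected if any two distinct vertices of $G$ are connected by a total-proper path. For a nontrivial connected graph $G$, the total-proper connection number $tpc(G)$ is the minimum number of colors in a total-coloring that makes $G$ total-proper connected. $S_n$ denotes the star on $n$ vertices, and $T(a,b)$ denotes the double star obtained from disjoint stars $S_a$ and $S_b$ by adding an edge between their center vertices (for $S_2$ either vertex may be taken as the center); so $T(2,n-2)$ is the tree on $n$ vertices with maximum degree $n-2$. *)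

theory Defs
  imports Main
begin

record 'a ugraph =
  verts :: "'a set"
  edges :: "'a set set"

definition simple_graph :: "'a ugraph \<Rightarrow> bool" where
  "simple_graph G \<longleftrightarrow>
     finite (verts G) \<and> (\<forall>e \<in> edges G. e \<subseteq> verts G \<and> card e = 2)"

definition complement :: "'a ugraph \<Rightarrow> 'a ugraph" where
  "complement G =
     \<lparr>verts = verts G, edges = {e. e \<subseteq> verts G \<and> card e = 2 \<and> e \<notin> edges G}\<rparr>"

definition isomorphic :: "'a ugraph \<Rightarrow> 'b ugraph \<Rightarrow> bool" where
  "isomorphic G H \<longleftrightarrow>
     (\<exists>f. bij_betw f (verts G) (verts H) \<and>
        (\<forall>u \<in> verts G. \<forall>v \<in> verts G. {u, v} \<in> edges G \<longleftrightarrow> {f u, f v} \<in> edges H))"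

definition path_between :: "'a ugraph \<Rightarrow> 'a \<Rightarrow> 'a list \<Rightarrow> 'a \<Rightarrow> bool" where
  "path_between G u p v \<longleftrightarrow>
     p \<noteq> [] \<and> hd p = u \<and> last p = v \<and> set p \<subseteq> verts G \<and> distinct p \<and>
     (\<forall>i. i + 1 < length p \<longrightarrow> {p ! i, p ! (i + 1)} \<in> edges G)"

definition connected_graph :: "'a ugraph \<Rightarrow> bool" where
  "connected_graph G \<longleftrightarrow>
     verts G \<noteq> {} \<and> (\<forall>u \<in> verts G. \<forall>v \<in> verts G. \<exists>p. path_between G u p v)"

text \<open>
  A total-coloring is a pair of a vertex coloring \<open>cv\<close> and an edge coloring \<open>ce\<close> that share
  the set of colors \<^typ>\<open>nat\<close>; only their values on the vertices and edges of the graph matter.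
  The internal vertices of a path \<open>p\<close> are the \<open>p ! i\<close> with \<open>0 < i\<close> and \<open>i + 1 < length p\<close>, and
  adjacency of edges and of internal vertices is understood within the path.
\<close>

definition total_proper_path :: "('a \<Rightarrow> nat) \<Rightarrow> ('a set \<Rightarrow> nat) \<Rightarrow> 'a list \<Rightarrow> bool" where
  "total_proper_path cv ce p \<longleftrightarrow>
     (\<forall>i. i + 2 < length p \<longrightarrow>
        ce {p ! i, p ! (i + 1)} \<noteq> ce {p ! (i + 1), p ! (i + 2)}) \<and>
     (\<forall>i. 0 < i \<and> i + 2 < length p \<longrightarrow> cv (p ! i) \<noteq> cv (p ! (i + 1))) \<and>
     (\<forall>i. 0 < i \<and> i + 1 < length p \<longrightarrow>
        cv (p ! i) \<noteq> ce {p ! (i - 1), p ! i} \<and> cv (p ! i) \<noteq> ce {p ! i, p ! (i + 1)})"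

definition total_proper_connected ::
  "'a ugraph \<Rightarrow> ('a \<Rightarrow> nat) \<Rightarrow> ('a set \<Rightarrow> nat) \<Rightarrow> bool" where
  "total_proper_connected G cv ce \<longleftrightarrow>
     (\<forall>u \<in> verts G. \<forall>v \<in> verts G. u \<noteq> v \<longrightarrow>
        (\<exists>p. path_between G u p v \<and> total_proper_path cv ce p))"

text \<open>
  For a connected finite simple graph the minimum is attained (giving all vertices and edges
  pairwise distinct colors makes every path total-proper); for other graphs \<open>tpc\<close> is irrelevant.
\<close>

definition tpc :: "'a ugraph \<Rightarrow> nat" where
  "tpc G = (LEAST k. \<exists>cv ce. total_proper_connected G cv ce \<and>
                              card (cv ` verts G \<union> ce ` edges G) = k)"

text \<open>The star on \<open>k\<close> vertices (for \<open>k \<ge> 1\<close>), with center \<open>0\<close>.\<close>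

definition star :: "nat \<Rightarrow> nat ugraph" where
  "star k = \<lparr>verts = {..<k}, edges = {{0, i} | i. 0 < i \<and> i < k}\<rparr>"

definition double_star :: "nat \<Rightarrow> nat \<Rightarrow> (nat + nat) ugraph" where
  "double_star a b =
     \<lparr>verts = Inl ` verts (star a) \<union> Inr ` verts (star b),
      edges = (\<lambda>e. Inl ` e) ` edges (star a) \<union> (\<lambda>e. Inr ` e) ` edges (star b)
              \<union> {{Inl 0, Inr 0}}\<rparr>"

end

theory Submission
  imports Defs
begin

text \<open>
  Throughout, \<open>E\<close> is a set of edges, \<open>V\<close> a vertex set, and \<open>- E\<close> plays the role of the complementary
  edge set: only pairs of distinct vertices are ever looked up, so no other members of \<open>E\<close> or
  \<open>- E\<close> matter. This makes passing to a subset of the vertices and to the complement cheap.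

  The upper bound comes from spanning trees. A tree of maximum degree \<open>d \<ge> 2\<close> has a total
  coloring with \<open>d + 1\<close> colors in which every path is total-proper: color greedily while the tree
  grows leaf by leaf (\<open>tree_proper_total\<close>). So it suffices to find spanning trees of \<open>G\<close> and of its
  complement whose maximum degrees \<open>d\<close>, \<open>d'\<close> satisfy \<open>d + d' \<le> n - 1\<close>; then the sum of the two
  numbers is at most \<open>n + 1\<close>. Such trees exist unless \<open>G\<close> or its complement is a broom, the
  tree \<open>T(2, n - 2)\<close> (\<open>broom_or_cheaply_spanned\<close>).

  This is proved by induction on \<open>n\<close>. If \<open>G\<close> and its complement are connected and \<open>n \<ge> 5\<close>, some
  vertex \<open>u\<close> can be deleted so that both stay connected (\<open>removable_vertex\<close>). To put \<open>u\<close> back, add it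
  as a leaf to both trees. The heart of the matter is that one of the two maximum degrees need not
  grow (\<open>spanned_extend\<close>): in a tree of maximum degree \<open>d \<ge> 3\<close> fewer than half of the vertices have
  degree \<open>d\<close>, and a Hamiltonian path can absorb \<open>u\<close> unless the neighbors of \<open>u\<close> are inner vertices
  no two of which are consecutive, which again is fewer than half. The neighbors of \<open>u\<close> in \<open>G\<close>
  and in the complement partition the other vertices, so one of the two sets has at least half of them.
  Hence \<open>d + d'\<close> grows by at most one, as \<open>n\<close> does. The induction starts at the path
  on four vertices, where \<open>d + d' = n\<close>; adding a fifth vertex gives two Hamiltonian paths or a broom
  (\<open>P4_extend\<close>). A broom also has \<open>d + d' = n\<close>, and its one-vertex extensions are again brooms or have
  better trees (\<open>broom_insert\<close>).

  For a broom the sum is exactly \<open>n + 2\<close>. Two neighbors of the center are joined by a single path,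
  which passes through the center, so the \<open>n - 2\<close> edges at the center and the center itself have
  distinct colors (\<open>broom_tpc_ge\<close>), while its complement has a Hamiltonian path and is not complete,
  which gives \<open>3\<close>.
\<close>

section \<open>Trees and their degrees\<close>

inductive tree :: "'a set \<Rightarrow> 'a set set \<Rightarrow> bool" where
  single: "tree {r} {}"
| leaf: "tree V F \<Longrightarrow> w \<in> V \<Longrightarrow> u \<notin> V \<Longrightarrow> tree (insert u V) (insert {w, u} F)"

definition degree :: "'a set set \<Rightarrow> 'a \<Rightarrow> nat" where
  "degree F v = card {e \<in> F. v \<in> e}"

abbreviation walk :: "'a set set \<Rightarrow> 'a list \<Rightarrow> bool" where
  "walk E \<equiv> successively (\<lambda>a b. {a, b} \<in> E)"

lemma tree_finite: "tree V F \<Longrightarrow> finite V \<and> finite F \<and> V \<noteq> {}"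
  by (induction rule: tree.induct) auto

lemma tree_edges: "tree V F \<Longrightarrow> e \<in> F \<Longrightarrow> e \<subseteq> V \<and> card e = 2"
  by (induction rule: tree.induct) (auto simp: card_2_iff)

lemma degree_leaf:
  assumes "tree V F" "w \<in> V" "u \<notin> V"
  shows "degree (insert {w, u} F) x =
    (if x = w then Suc (degree F w) else if x = u then 1 else degree F x)"
proof -
  have fin: "finite F" using tree_finite assms(1) by auto
  have new: "u \<notin> e" if "e \<in> F" for e using tree_edges[OF assms(1) that] assms(3) by auto
  then have "{w, u} \<notin> F" by auto
  moreover have "{e \<in> insert {w, u} F. w \<in> e} = insert {w, u} {e \<in> F. w \<in> e}" by auto
  moreover have "{e \<in> insert {w, u} F. u \<in> e} = {{w, u}}" using new by auto
  moreover have "{e \<in> insert {w, u} F. x \<in> e} = {e \<in> F. x \<in> e}" if "x \<noteq> w" "x \<noteq> u"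
    using that by auto
  ultimately show ?thesis using fin by (auto simp: degree_def)
qed

lemma tree_sum_degree: "tree V F \<Longrightarrow> (\<Sum>v\<in>V. degree F v) + 2 = 2 * card V"
proof (induction rule: tree.induct)
  case (single r)
  then show ?case by (simp add: degree_def)
next
  case (leaf V F w u)
  have fin: "finite V" using tree_finite leaf by auto
  let ?d = "degree (insert {w, u} F)"
  note d = degree_leaf[OF leaf.hyps]
  have "(\<Sum>v\<in>V. ?d v) = (\<Sum>v\<in>V. degree F v + (if v = w then 1 else 0))"
    using leaf.hyps by (intro sum.cong) (auto simp: d)
  also have "\<dots> = (\<Sum>v\<in>V. degree F v) + 1"
    using fin leaf.hyps by (simp add: sum.distrib)
  finally have "(\<Sum>v\<in>V. ?d v) = (\<Sum>v\<in>V. degree F v) + 1" .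
  moreover have "?d u = 1" using leaf.hyps by (auto simp: d)
  ultimately show ?case using fin leaf by simp
qed

lemma tree_degree_pos: "tree V F \<Longrightarrow> 2 \<le> card V \<Longrightarrow> v \<in> V \<Longrightarrow> 1 \<le> degree F v"
proof (induction rule: tree.induct)
  case (single r)
  then show ?case by simp
next
  case (leaf V F w u)
  show ?case
  proof (cases "v = u \<or> v = w")
    case True
    then show ?thesis by (auto simp: degree_leaf[OF leaf.hyps])
  next
    case False
    have "finite V" using tree_finite leaf by auto
    moreover have "{v, w} \<subseteq> V" "v \<noteq> w" using False leaf by auto
    ultimately have "2 \<le> card V" using card_mono[of V "{v, w}"] by auto
    then show ?thesis using leaf False by (auto simp: degree_leaf[OF leaf.hyps(1-3)])
  qed
qed

text \<open>
  The degrees sum to \<open>2 * card V - 2\<close>. Each vertex contributes at least one, each vertex of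
  \<open>N\<close> at least two more, so \<open>card V + 2 * card N \<le> 2 * card V - 2\<close>.
\<close>

lemma tree_few_branch_vertices:
  assumes "tree V F" "2 \<le> card V" "N \<subseteq> V" "\<And>v. v \<in> N \<Longrightarrow> 3 \<le> degree F v"
  shows "2 * card N < card V"
proof -
  have fin: "finite V" using tree_finite assms(1) by auto
  then have finN: "finite N" using assms(3) finite_subset by auto
  have "card V + 2 * card N = (\<Sum>v\<in>V. 1 + (if v \<in> N then 2 else 0))"
    using fin assms(3) by (simp only: sum.distrib) (simp add: sum.If_cases Int_absorb1)
  also have "\<dots> \<le> (\<Sum>v\<in>V. degree F v)"
    using tree_degree_pos[OF assms(1,2)] assms(4) by (intro sum_mono) auto
  finally show ?thesis using tree_sum_degree[OF assms(1)] assms(2) by linarith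
qed

lemma tree_walk:
  "tree V F \<Longrightarrow> a \<in> V \<Longrightarrow> b \<in> V \<Longrightarrow>
    \<exists>p. p \<noteq> [] \<and> hd p = a \<and> last p = b \<and> set p \<subseteq> V \<and> distinct p \<and> walk F p"
proof (induction arbitrary: a b rule: tree.induct)
  case (single r)
  then show ?case by (intro exI[of _ "[r]"]) auto
next
  case (leaf V F w u)
  let ?F = "insert {w, u} F"
  have mono: "walk ?F p" if "walk F p" for p
    using that by (rule successively_mono) auto
  consider "a = u" "b = u" | "a = u" "b \<in> V" | "a \<in> V" "b = u" | "a \<in> V" "b \<in> V"
    using leaf.prems by auto
  then show ?case
  proof cases
    case 1
    then show ?thesis by (intro exI[of _ "[u]"]) auto
  next
    case 2
    obtain p where "p \<noteq> []" "hd p = w" "last p = b" "set p \<subseteq> V" "distinct p" "walk F p"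
      using leaf.IH[OF leaf.hyps(2) 2(2)] by auto
    then show ?thesis using mono 2 leaf.hyps
      by (intro exI[of _ "u # p"]) (auto simp: successively_Cons insert_commute)
  next
    case 3
    obtain p where "p \<noteq> []" "hd p = a" "last p = w" "set p \<subseteq> V" "distinct p" "walk F p"
      using leaf.IH[OF 3(1) leaf.hyps(2)] by auto
    then show ?thesis using mono 3 leaf.hyps
      by (intro exI[of _ "p @ [u]"]) (auto simp: successively_append_iff)
  next
    case 4
    obtain p where "p \<noteq> []" "hd p = a" "last p = b" "set p \<subseteq> V" "distinct p" "walk F p"
      using leaf.IH[OF 4] by auto
    then show ?thesis using mono by blast
  qed
qed

text \<open>
  Concentrates a large degree at a prescribed vertex \<open>w\<close> while the other degrees stay as they are.
\<close>

lemma tree_add_leaves: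
  assumes "tree V F" "w \<in> V" "finite L" "L \<inter> V = {}"
  shows "\<exists>F'. tree (V \<union> L) F' \<and> F' \<subseteq> F \<union> (\<lambda>l. {w, l}) ` L \<and>
    (\<forall>v\<in>V - {w}. degree F' v = degree F v) \<and> degree F' w = degree F w + card L \<and>
    (\<forall>l\<in>L. degree F' l = 1)"
  using assms(3,4)
proof (induction L rule: finite_induct)
  case empty
  then show ?case using assms by (intro exI[of _ F]) auto
next
  case (insert l L)
  then obtain F' where F': "tree (V \<union> L) F'" "F' \<subseteq> F \<union> (\<lambda>l. {w, l}) ` L"
    "\<forall>v\<in>V - {w}. degree F' v = degree F v" "degree F' w = degree F w + card L"
    "\<forall>l\<in>L. degree F' l = 1" by auto
  have l: "l \<notin> V \<union> L" "w \<in> V \<union> L" using insert assms by auto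
  show ?case
    using leaf[OF F'(1) l(2,1)] F' l insert assms(2)
    by (intro exI[of _ "insert {w, l} F'"]) (auto simp: degree_leaf[OF F'(1) l(2,1)])
qed

section \<open>Total-proper colorings from spanning trees\<close>

lemma card_less_ex_outside: "finite A \<Longrightarrow> card A < card B \<Longrightarrow> \<exists>x\<in>B. x \<notin> A"
  by (meson card_mono leD subsetI)

text \<open>
  The usual proper total coloring of a graph with edge set \<open>F\<close>. It makes every path with
  edges in \<open>F\<close> total-proper.
\<close>

definition proper_total :: "'a set set \<Rightarrow> ('a \<Rightarrow> nat) \<Rightarrow> ('a set \<Rightarrow> nat) \<Rightarrow> bool" where
  "proper_total F cv ce \<longleftrightarrow>
     (\<forall>e\<in>F. \<forall>f\<in>F. e \<noteq> f \<longrightarrow> e \<inter> f \<noteq> {} \<longrightarrow> ce e \<noteq> ce f) \<and>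
     (\<forall>u v. {u, v} \<in> F \<longrightarrow> u \<noteq> v \<longrightarrow> cv u \<noteq> cv v) \<and>
     (\<forall>e\<in>F. \<forall>v\<in>e. cv v \<noteq> ce e)"

text \<open>
  Greedy coloring along the construction of the tree. When the leaf \<open>u\<close> is attached to \<open>w\<close>, the edge
  \<open>{w, u}\<close> must avoid the color of \<open>w\<close> and those of the at most \<open>d - 1\<close> edges already at \<open>w\<close>, and \<open>u\<close>
  must avoid the colors of \<open>w\<close> and of \<open>{w, u}\<close>; both choices succeed among \<open>d + 1 \<ge> 3\<close> colors.
\<close>

lemma tree_proper_total:
  "tree V F \<Longrightarrow> 2 \<le> d \<Longrightarrow> \<forall>v\<in>V. degree F v \<le> d \<Longrightarrow>
    \<exists>cv ce. proper_total F cv ce \<and> cv ` V \<subseteq> {..d} \<and> range ce \<subseteq> {..d}"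
proof (induction rule: tree.induct)
  case (single r)
  show ?case
    by (intro exI[of _ "\<lambda>_. 0"]) (auto simp: proper_total_def)
next
  case (leaf V F w u)
  note deg = degree_leaf[OF leaf.hyps]
  have wu: "w \<noteq> u" using leaf.hyps by auto
  have "degree F v \<le> d" if "v \<in> V" for v
  proof -
    have "degree F v \<le> degree (insert {w, u} F) v"
      using that leaf.hyps by (auto simp: deg)
    then show ?thesis using leaf.prems that by (meson insertI2 le_trans)
  qed
  then obtain cv ce where
    cc: "proper_total F cv ce" "cv ` V \<subseteq> {..d}" "range ce \<subseteq> {..d}"
    using leaf by blast
  have fin: "finite F" using tree_finite leaf by auto
  have "Suc (degree F w) \<le> d" using leaf.prems(2) leaf.hyps(2) deg by (metis insertI2)
  moreover have "card (ce ` {e \<in> F. w \<in> e}) \<le> degree F w"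
    unfolding degree_def using fin by (intro card_image_le) auto
  moreover have "card (insert (cv w) (ce ` {e \<in> F. w \<in> e})) \<le> Suc (card (ce ` {e \<in> F. w \<in> e}))"
    using fin by (simp add: card_insert_if)
  ultimately have "card (insert (cv w) (ce ` {e \<in> F. w \<in> e})) < card {..d}"
    by simp
  then obtain k where k: "k \<le> d" "k \<noteq> cv w" "k \<notin> ce ` {e \<in> F. w \<in> e}"
    using card_less_ex_outside[of "insert (cv w) (ce ` {e \<in> F. w \<in> e})" "{..d}"] fin by auto
  have "card {cv w, k} < card {..d}" using leaf.prems(1) k by auto
  then obtain j where j: "j \<le> d" "j \<noteq> cv w" "j \<noteq> k"
    using card_less_ex_outside[of "{cv w, k}" "{..d}"] by auto
  have new: "u \<notin> e" if "e \<in> F" for e using tree_edges[OF leaf.hyps(1) that] leaf.hyps by auto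
  have newe: "{w, u} \<notin> F" using new by auto
  have pE: "ce e \<noteq> ce f" if "e \<in> F" "f \<in> F" "e \<noteq> f" "e \<inter> f \<noteq> {}" for e f
    using cc(1) that by (simp add: proper_total_def)
  have pV: "cv a \<noteq> cv b" if "{a, b} \<in> F" "a \<noteq> b" for a b
    using cc(1) that by (simp add: proper_total_def)
  have pVE: "cv v \<noteq> ce e" if "e \<in> F" "v \<in> e" for e v
    using cc(1) that by (simp add: proper_total_def)
  have "proper_total (insert {w, u} F) (cv(u := j)) (ce({w, u} := k))"
    unfolding proper_total_def
  proof (intro conjI ballI allI impI)
    fix e f assume *: "e \<in> insert {w, u} F" "f \<in> insert {w, u} F" "e \<noteq> f" "e \<inter> f \<noteq> {}"
    have meet: "w \<in> g" if "g \<in> F" "{w, u} \<inter> g \<noteq> {}" for g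
      using that new by blast
    consider "e = {w, u}" "f \<in> F" | "f = {w, u}" "e \<in> F" | "e \<in> F" "f \<in> F"
      using * by blast
    then show "(ce({w, u} := k)) e \<noteq> (ce({w, u} := k)) f"
    proof cases
      case 1
      then have "f \<in> {e \<in> F. w \<in> e}" using meet * by blast
      then have "ce f \<noteq> k" using k(3) by blast
      then show ?thesis using 1 * by simp
    next
      case 2
      then have "e \<in> {e \<in> F. w \<in> e}" using meet * by blast
      then have "ce e \<noteq> k" using k(3) by blast
      then show ?thesis using 2 * by simp
    next
      case 3
      then have "ce e \<noteq> ce f" using pE[OF _ _ *(3,4)] by blast
      moreover have "e \<noteq> {w, u}" "f \<noteq> {w, u}" using 3 newe by metis+
      ultimately show ?thesis by (simp only: fun_upd_other not_False_eq_True)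
    qed
  next
    fix a b assume *: "{a, b} \<in> insert {w, u} F" "a \<noteq> b"
    show "(cv(u := j)) a \<noteq> (cv(u := j)) b"
    proof (cases "{a, b} \<in> F")
      case True
      then have "cv a \<noteq> cv b" using pV[OF _ *(2)] by blast
      then show ?thesis using new[OF True] by auto
    next
      case False
      then show ?thesis using * j wu by (auto simp: doubleton_eq_iff)
    qed
  next
    fix e v assume *: "e \<in> insert {w, u} F" "v \<in> e"
    show "(cv(u := j)) v \<noteq> (ce({w, u} := k)) e"
    proof (cases "e \<in> F")
      case True
      then have "cv v \<noteq> ce e" using pVE[OF _ *(2)] by blast
      moreover have "v \<noteq> u" "e \<noteq> {w, u}" using new[OF True] * by auto
      ultimately show ?thesis by simp
    next
      case False
      then show ?thesis using * j k wu by auto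
    qed
  qed
  moreover have "(cv(u := j)) ` insert u V \<subseteq> {..d}" "range (ce({w, u} := k)) \<subseteq> {..d}"
    using cc(2,3) j k by (auto simp: image_subset_iff)
  ultimately show ?case by blast
qed

lemma proper_total_walk:
  assumes "proper_total F cv ce" "walk F p" "distinct p"
  shows "total_proper_path cv ce p"
proof -
  have w: "{p ! i, p ! Suc i} \<in> F" if "Suc i < length p" for i
    using assms(2) that by (simp add: successively_conv_nth)
  have ne: "p ! i \<noteq> p ! j" if "i < length p" "j < length p" "i \<noteq> j" for i j
    using assms(3) that nth_eq_iff_index_eq by blast
  show ?thesis
    unfolding total_proper_path_def
  proof (intro conjI allI impI)
    fix i assume i: "i + 2 < length p"
    have "{p ! i, p ! Suc i} \<noteq> {p ! Suc i, p ! Suc (Suc i)}"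
      using ne[of i "Suc (Suc i)"] ne[of i "Suc i"] i by (auto simp: doubleton_eq_iff)
    moreover have "{p ! i, p ! Suc i} \<inter> {p ! Suc i, p ! Suc (Suc i)} \<noteq> {}" by auto
    ultimately show "ce {p ! i, p ! (i + 1)} \<noteq> ce {p ! (i + 1), p ! (i + 2)}"
      using w[of i] w[of "Suc i"] i assms(1) unfolding proper_total_def by simp
  next
    fix i assume i: "0 < i \<and> i + 2 < length p"
    show "cv (p ! i) \<noteq> cv (p ! (i + 1))"
      using w[of i] ne[of i "Suc i"] i assms(1) unfolding proper_total_def by simp
  next
    fix i assume i: "0 < i \<and> i + 1 < length p"
    show "cv (p ! i) \<noteq> ce {p ! (i - 1), p ! i}"
      using w[of "i - 1"] i assms(1) unfolding proper_total_def by simp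
  next
    fix i assume i: "0 < i \<and> i + 1 < length p"
    show "cv (p ! i) \<noteq> ce {p ! i, p ! (i + 1)}"
      using w[of i] i assms(1) unfolding proper_total_def by simp
  qed
qed

lemma tree_total_proper_connected:
  assumes "tree (verts G) F" "F \<subseteq> edges G" "2 \<le> d" "\<forall>v\<in>verts G. degree F v \<le> d"
  shows "\<exists>cv ce. total_proper_connected G cv ce \<and> card (cv ` verts G \<union> ce ` edges G) \<le> d + 1"
proof -
  obtain cv ce where cc: "proper_total F cv ce" "cv ` verts G \<subseteq> {..d}" "range ce \<subseteq> {..d}"
    using tree_proper_total[OF assms(1,3,4)] by auto
  have "total_proper_connected G cv ce"
    unfolding total_proper_connected_def
  proof (intro ballI impI)
    fix u v assume "u \<in> verts G" "v \<in> verts G"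
    then obtain p where p: "p \<noteq> []" "hd p = u" "last p = v" "set p \<subseteq> verts G" "distinct p"
      "walk F p" using tree_walk[OF assms(1)] by metis
    then have "path_between G u p v"
      using assms(2) unfolding path_between_def successively_conv_nth by auto
    then show "\<exists>p. path_between G u p v \<and> total_proper_path cv ce p"
      using proper_total_walk[OF cc(1)] p by auto
  qed
  moreover have "card (cv ` verts G \<union> ce ` edges G) \<le> card {..d}"
    using cc(2,3) by (intro card_mono) (auto simp: image_subset_iff)
  ultimately show ?thesis by auto
qed

lemma tpc_le_tree:
  assumes "tree (verts G) F" "F \<subseteq> edges G" "2 \<le> d" "\<forall>v\<in>verts G. degree F v \<le> d"
  shows "tpc G \<le> d + 1"
proof -
  obtain cv ce where cc: "total_proper_connected G cv ce"
    "card (cv ` verts G \<union> ce ` edges G) \<le> d + 1"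
    using tree_total_proper_connected[OF assms] by auto
  have "tpc G \<le> card (cv ` verts G \<union> ce ` edges G)"
    unfolding tpc_def using cc(1) by (intro Least_le) auto
  then show ?thesis using cc(2) by linarith
qed

text \<open>
  The spanning tree guarantees that some coloring is total-proper connected, so that the least
  number in the definition of \<open>tpc\<close> is attained.
\<close>

lemma tpc_geI:
  assumes "tree (verts G) F" "F \<subseteq> edges G"
    and "\<And>cv ce. total_proper_connected G cv ce \<Longrightarrow> k \<le> card (cv ` verts G \<union> ce ` edges G)"
  shows "k \<le> tpc G"
proof -
  define d where "d = max 2 (Max (degree F ` verts G))"
  have "finite (degree F ` verts G)" using tree_finite[OF assms(1)] by auto
  then have "\<forall>v\<in>verts G. degree F v \<le> d" unfolding d_def
    by (auto intro: Max_ge le_max_iff_disj[THEN iffD2])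
  then obtain cv ce where "total_proper_connected G cv ce"
    using tree_total_proper_connected[OF assms(1,2), of d] unfolding d_def by auto
  then have "\<exists>k cv ce. total_proper_connected G cv ce \<and> card (cv ` verts G \<union> ce ` edges G) = k"
    by blast
  from LeastI_ex[OF this] obtain cv ce
    where "total_proper_connected G cv ce" "card (cv ` verts G \<union> ce ` edges G) = tpc G"
    unfolding tpc_def by blast
  then show ?thesis using assms(3) by metis
qed

text \<open>
  A path between nonadjacent vertices has an inner vertex; this vertex and its two edges on the
  path have three distinct colors.
\<close>

lemma tpc_noncomplete:
  assumes "simple_graph G" "tree (verts G) F" "F \<subseteq> edges G" "u \<in> verts G" "v \<in> verts G" "u \<noteq> v" "{u, v} \<notin> edges G"
  shows "3 \<le> tpc G"
proof (rule tpc_geI[OF assms(2,3)])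
  fix cv ce assume "total_proper_connected G cv ce"
  then obtain p where p: "path_between G u p v" "total_proper_path cv ce p"
    using assms unfolding total_proper_connected_def by blast
  have "2 < length p"
  proof (rule ccontr)
    assume "\<not> 2 < length p"
    then consider "p = []" | x where "p = [x]" | x y where "p = [x, y]"
      by (cases p; cases "tl p"; cases "tl (tl p)") auto
    then show False using p(1) assms by cases (auto simp: path_between_def)
  qed
  then have q: "p ! 1 \<in> verts G" "{p ! 0, p ! 1} \<in> edges G" "{p ! 1, p ! 2} \<in> edges G"
    using p(1) unfolding path_between_def by (auto simp: numeral_2_eq_2 subset_iff)
  let ?C = "{cv (p ! 1), ce {p ! 0, p ! 1}, ce {p ! 1, p ! 2}}"
  have "cv (p ! 1) \<noteq> ce {p ! 0, p ! 1}" "cv (p ! 1) \<noteq> ce {p ! 1, p ! 2}"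
    "ce {p ! 0, p ! 1} \<noteq> ce {p ! 1, p ! 2}"
    using p(2) \<open>2 < length p\<close> unfolding total_proper_path_def
    by (auto simp: numeral_2_eq_2 dest: spec[of _ 0] spec[of _ 1])
  then have "3 = card ?C" by simp
  also have "\<dots> \<le> card (cv ` verts G \<union> ce ` edges G)"
  proof (rule card_mono)
    have "edges G \<subseteq> Pow (verts G)" using assms(1) by (auto simp: simple_graph_def)
    then have "finite (edges G)" using assms(1) finite_subset by (auto simp: simple_graph_def)
    then show "finite (cv ` verts G \<union> ce ` edges G)"
      using assms(1) by (auto simp: simple_graph_def)
  qed (use q in auto)
  finally show "3 \<le> card (cv ` verts G \<union> ce ` edges G)" .
qed

section \<open>Graphs connected together with their complement\<close>

text \<open>
  Connectedness as the absence of empty cuts. This form passes to vertex subsets and to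
  complements without handling any paths.
\<close>

definition conn :: "'a set set \<Rightarrow> 'a set \<Rightarrow> bool" where
  "conn E V \<longleftrightarrow> (\<forall>A. A \<noteq> {} \<longrightarrow> A \<subset> V \<longrightarrow> (\<exists>a\<in>A. \<exists>b\<in>V - A. {a, b} \<in> E))"

lemma connD:
  assumes "conn E V" "A \<noteq> {}" "A \<subset> V"
  obtains a b where "a \<in> A" "b \<in> V" "b \<notin> A" "{a, b} \<in> E"
  using assms unfolding conn_def by (metis DiffE)

lemma connI:
  assumes "\<And>A. A \<noteq> {} \<Longrightarrow> A \<subset> V \<Longrightarrow> \<exists>a\<in>A. \<exists>b\<in>V - A. {a, b} \<in> E"
  shows "conn E V"
  using assms unfolding conn_def by blast

lemma conn_mono: "conn E V \<Longrightarrow> E \<subseteq> E' \<Longrightarrow> conn E' V"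
  unfolding conn_def by (meson subsetD)

lemma conn_singleton: "conn E {x}"
  by (rule connI) auto

lemma conn_insert:
  assumes "conn E S" "y \<in> S" "{x, y} \<in> E"
  shows "conn E (insert x S)"
proof (rule connI)
  fix A assume A: "A \<noteq> {}" "A \<subset> insert x S"
  have yx: "{y, x} \<in> E" using assms(3) by (simp add: insert_commute)
  show "\<exists>a\<in>A. \<exists>b\<in>insert x S - A. {a, b} \<in> E"
  proof (cases "A \<inter> S \<noteq> {} \<and> A \<inter> S \<subset> S")
    case True
    then obtain a b where "a \<in> A \<inter> S" "b \<in> S" "b \<notin> A \<inter> S" "{a, b} \<in> E"
      using connD[OF assms(1), of "A \<inter> S"] by metis
    then show ?thesis by blast
  next
    case False
    then consider "A \<inter> S = {}" | "S \<subseteq> A" by blast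
    then show ?thesis
    proof cases
      case 1
      then have "x \<in> A" "y \<notin> A" using A assms by blast+
      then show ?thesis using assms by blast
    next
      case 2
      then have "x \<notin> A" "y \<in> A" using A assms by blast+
      then show ?thesis using assms yx by blast
    qed
  qed
qed

lemma conn_neighbor:
  assumes "conn E (insert u V)" "u \<notin> V" "V \<noteq> {}"
  obtains w where "w \<in> V" "{w, u} \<in> E"
  using connD[OF assms(1), of V] assms(2,3) by (metis insert_iff psubsetI subset_insertI)

text \<open>
  Here \<open>S\<close> is a module: its members have the same neighbors outside \<open>S\<close>. The vertex \<open>y\<close> can replace
  \<open>x\<close> on every edge leaving \<open>S\<close>, and an outside neighbor \<open>z\<close> of \<open>S\<close> keeps the rest of \<open>S\<close>
  together even if \<open>S\<close> itself falls apart.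
\<close>

lemma conn_remove_from_module:
  assumes "conn E V" "S \<subset> V" "x \<in> S" "y \<in> S" "x \<noteq> y"
    and module: "\<And>z s t. z \<in> V - S \<Longrightarrow> s \<in> S \<Longrightarrow> t \<in> S \<Longrightarrow> {z, s} \<in> E \<Longrightarrow> {z, t} \<in> E"
  shows "conn E (V - {x})"
proof (rule connI)
  fix A assume A: "A \<noteq> {}" "A \<subset> V - {x}"
  obtain s z where z: "s \<in> S" "z \<in> V" "z \<notin> S" "{s, z} \<in> E"
    using connD[OF assms(1), of S] assms(2,3) by blast
  then have zS: "{z, t} \<in> E" "{t, z} \<in> E" if "t \<in> S" for t
    using module[of z s t] that by (auto simp: insert_commute)
  have zx: "z \<noteq> x" using z assms by blast
  show "\<exists>a\<in>A. \<exists>b\<in>V - {x} - A. {a, b} \<in> E"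
  proof (cases "\<exists>t\<in>S. \<exists>t'\<in>S. t \<in> A \<and> t' \<notin> A \<and> t' \<noteq> x")
    case True
    then obtain t t' where t: "t \<in> S" "t' \<in> S" "t \<in> A" "t' \<notin> A" "t' \<noteq> x" by blast
    show ?thesis
    proof (cases "z \<in> A")
      case True
      then show ?thesis using t zS(1)[of t'] assms(2) by blast
    next
      case False
      then show ?thesis using t zS(2)[of t] z(2) zx by blast
    qed
  next
    case False
    \<comment> \<open>Put \<open>x\<close> on the same side as its twin \<open>y\<close>.\<close>
    define B where "B = (if y \<in> A then insert x A else A)"
    have "B \<noteq> {}" "B \<subset> V" using A assms(2-5) unfolding B_def by (auto split: if_splits)
    then obtain a b where ab: "a \<in> B" "b \<in> V" "b \<notin> B" "{a, b} \<in> E"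
      using connD[OF assms(1)] by metis
    have ba: "{b, a} \<in> E" using ab by (simp add: insert_commute)
    consider "a \<noteq> x" "b \<noteq> x" | "a = x" | "b = x" by blast
    then show ?thesis
    proof cases
      case 1
      then show ?thesis using ab unfolding B_def by (auto split: if_splits)
    next
      case 2
      then have y: "y \<in> A" "b \<notin> A" "b \<noteq> x" using ab A unfolding B_def by (auto split: if_splits)
      then have "b \<notin> S" using False assms(4) by blast
      then have "{b, y} \<in> E" using module[of b x y] ab(2) ba 2 assms by blast
      then have "{y, b} \<in> E" by (simp add: insert_commute)
      then show ?thesis using y ab(2) by blast
    next
      case 3
      then have y: "y \<notin> A" "a \<in> A" "a \<in> V" "a \<noteq> x" using ab A unfolding B_def by (auto split: if_splits)
      then have "a \<notin> S" using False assms(4,5) by blast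
      then have "{a, y} \<in> E" using module[of a x y] y ab 3 assms by blast
      then show ?thesis using y assms by blast
    qed
  qed
qed

definition induced_P4 :: "'a set set \<Rightarrow> 'a \<Rightarrow> 'a \<Rightarrow> 'a \<Rightarrow> 'a \<Rightarrow> bool" where
  "induced_P4 E a b c d \<longleftrightarrow> distinct [a, b, c, d] \<and>
     {a, b} \<in> E \<and> {b, c} \<in> E \<and> {c, d} \<in> E \<and> {a, c} \<notin> E \<and> {a, d} \<notin> E \<and> {b, d} \<notin> E"

lemma induced_P4_complement: "induced_P4 E a b c d \<Longrightarrow> induced_P4 (- E) b d a c"
  by (auto simp: induced_P4_def insert_commute)

lemma induced_P4_complement': "induced_P4 (- E) a b c d \<Longrightarrow> induced_P4 E b d a c"
  using induced_P4_complement[of "- E"] by simp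

lemma induced_P4_conn: "induced_P4 E a b c d \<Longrightarrow> conn E {a, b, c, d}"
  by (intro conn_insert[of _ _ b] conn_insert[of _ _ c] conn_insert[of _ _ d] conn_singleton)
     (auto simp: induced_P4_def)

text \<open>
  If the complementary graph on \<open>V - {v}\<close> splits into \<open>A\<close> and \<open>B\<close>, all edges between \<open>A\<close> and \<open>B\<close> are in \<open>E\<close>.
  Since the complement is connected, \<open>v\<close> has a non-neighbor \<open>b'\<close> in \<open>B\<close>. If \<open>v\<close> also has a
  neighbor in \<open>A\<close>, a complementary edge leaves the neighbors of \<open>v\<close> in \<open>A\<close>; it can only go to a
  non-neighbor of \<open>v\<close> in \<open>A\<close>. With \<open>a1\<close>, \<open>a2\<close> its ends, \<open>v, a1, b', a2\<close> is an induced path.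
\<close>

lemma P4_of_co_cut_vertex:
  assumes "conn E V" "conn (- E) V" "v \<in> V" "\<not> conn (- E) (V - {v})"
  shows "\<exists>a b c d. {a, b, c, d} \<subseteq> V \<and> induced_P4 E a b c d"
proof -
  have *: "\<exists>a b c d. {a, b, c, d} \<subseteq> V \<and> induced_P4 E a b c d"
    if A: "A \<noteq> {}" "B \<noteq> {}" "A \<union> B = V - {v}" "A \<inter> B = {}"
      and full: "\<And>a b. a \<in> A \<Longrightarrow> b \<in> B \<Longrightarrow> {a, b} \<in> E"
      and nb: "x \<in> A" "{v, x} \<in> E" for A B x
  proof -
    obtain b' w where "b' \<in> B" "w \<in> V" "w \<notin> B" "{b', w} \<in> - E"
      using connD[OF assms(2), of B] A assms(3) by blast
    moreover have "w = v" using calculation A full[of w b'] by (auto simp: insert_commute)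
    ultimately have b: "b' \<in> B" "{v, b'} \<notin> E" by (auto simp: insert_commute)
    \<comment> \<open>The cut of the complement around the neighbors of \<open>v\<close> in \<open>A\<close>.\<close>
    obtain a1 a2 where a: "a1 \<in> {a \<in> A. {v, a} \<in> E}" "a2 \<in> V" "a2 \<notin> {a \<in> A. {v, a} \<in> E}" "{a1, a2} \<in> - E"
      using connD[OF assms(2), of "{a \<in> A. {v, a} \<in> E}"] nb A(3) assms(3) by blast
    have "a2 \<noteq> v" "a2 \<notin> B" using a full[of a1 a2] by (auto simp: insert_commute)
    then have a2: "a2 \<in> A" "{v, a2} \<notin> E" using a A(3) by auto
    have "a1 \<noteq> a2" using a by auto
    moreover have "a1 \<noteq> v" "b' \<noteq> v" "a2 \<noteq> v" "a1 \<noteq> b'" "a2 \<noteq> b'" using a a2 b A(3,4) by blast+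
    ultimately have "induced_P4 E v a1 b' a2"
      using a a2 b full[of a1 b'] full[of a2 b'] by (auto simp: induced_P4_def insert_commute)
    moreover have "{v, a1, b', a2} \<subseteq> V" using a a2 b A(3) assms(3) by auto
    ultimately show ?thesis by blast
  qed
  obtain A where A: "A \<noteq> {}" "A \<subset> V - {v}"
    and noe: "\<And>a b. a \<in> A \<Longrightarrow> b \<in> V - {v} - A \<Longrightarrow> {a, b} \<in> E"
    using assms(4) unfolding conn_def by (metis ComplI)
  have "{v} \<subset> V" using A assms(3) by blast
  then obtain u x where "u \<in> {v}" "x \<in> V" "x \<notin> {v}" "{u, x} \<in> E"
    using connD[OF assms(1), of "{v}"] by (metis insert_not_empty)
  then have x: "x \<in> V" "x \<noteq> v" "{v, x} \<in> E" by auto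
  show ?thesis
  proof (cases "x \<in> A")
    case True
    then show ?thesis using *[of A "V - {v} - A" x] A noe x by blast
  next
    case False
    have "{b, a} \<in> E" if "a \<in> A" "b \<in> V - {v} - A" for a b
      using noe[OF that] by (simp add: insert_commute)
    then show ?thesis using *[of "V - {v} - A" A x] False A x by blast
  qed
qed

text \<open>
  Delete vertices as long as both graphs stay connected. Two vertices are never connected in both
  graphs, so at some point the deletion of \<open>v\<close> disconnects one of them, and \<open>P4_of_co_cut_vertex\<close>
  applies to \<open>E\<close> or to \<open>- E\<close>.
\<close>

lemma P4_exists:
  assumes "finite V" "conn E V" "conn (- E) V" "2 \<le> card V"
  shows "\<exists>a b c d. {a, b, c, d} \<subseteq> V \<and> induced_P4 E a b c d"
  using assms
proof (induction "card V" arbitrary: V rule: less_induct)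
  case less
  obtain v where v: "v \<in> V" using less.prems by (metis card.empty ex_in_conv not_numeral_le_zero)
  consider "\<not> conn (- E) (V - {v})" | "\<not> conn E (V - {v})" |
    "conn E (V - {v})" "conn (- E) (V - {v})" by blast
  then show ?case
  proof cases
    case 1
    then show ?thesis using P4_of_co_cut_vertex[OF less.prems(2,3) v] by simp
  next
    case 2
    then obtain a b c d where "{a, b, c, d} \<subseteq> V" "induced_P4 (- E) a b c d"
      using P4_of_co_cut_vertex[of "- E" V v] less.prems v by auto
    then show ?thesis using induced_P4_complement'[of E a b c d] by blast
  next
    case 3
    have "card (V - {v}) \<ge> 2"
    proof (rule ccontr)
      assume "\<not> card (V - {v}) \<ge> 2"
      then have "card (V - {v}) = 1" using less.prems v by (simp add: card_Diff_singleton)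
      then obtain x where "V - {v} = {x}" by (auto simp: card_1_singleton_iff)
      then have V: "V = {v, x}" "v \<noteq> x" using v by auto
      have "{v, x} \<in> E" "{v, x} \<in> - E"
        using connD[OF less.prems(2), of "{v}"] connD[OF less.prems(3), of "{v}"] V by auto
      then show False by simp
    qed
    moreover have "card (V - {v}) < card V" using less.prems v by (intro card_Diff1_less) auto
    ultimately obtain a b c d where "{a, b, c, d} \<subseteq> V - {v}" "induced_P4 E a b c d"
      using less.hyps[of "V - {v}"] 3 less.prems by auto
    then show ?thesis by blast
  qed
qed

text \<open>
  Take a maximal proper subset \<open>S\<close> with at least four vertices on which both graphs are connected;
  an induced path on four vertices shows that there is one. If \<open>S\<close> misses only one vertex, that
  vertex can be deleted. Otherwise no outside vertex can be added to \<open>S\<close>, so each is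
  adjacent to all or to none of \<open>S\<close>: then \<open>S\<close> is a module in both graphs, and any of its
  vertices can be deleted.
\<close>

lemma removable_vertex:
  assumes "finite V" "conn E V" "conn (- E) V" "5 \<le> card V"
  shows "\<exists>v\<in>V. conn E (V - {v}) \<and> conn (- E) (V - {v})"
proof -
  let ?P = "\<lambda>S. S \<subset> V \<and> conn E S \<and> conn (- E) S \<and> 4 \<le> card S"
  obtain a b c d where P4: "{a, b, c, d} \<subseteq> V" "induced_P4 E a b c d"
    using P4_exists[OF assms(1-3)] assms(4) by auto
  have eq: "{b, d, a, c} = {a, b, c, d}" by auto
  have c4: "card {a, b, c, d} = 4" using P4(2) by (auto simp: induced_P4_def)
  then have "{a, b, c, d} \<noteq> V" using assms(4) by (metis Suc_n_not_le_n eval_nat_numeral(3))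
  then have "{a, b, c, d} \<subset> V" using P4(1) by (rule psubsetI[rotated])
  then have "?P {a, b, c, d}"
    using induced_P4_conn[OF P4(2)] induced_P4_conn[OF induced_P4_complement[OF P4(2)]] c4
    unfolding eq by (simp only: order_refl simp_thms)
  moreover have "finite {S. ?P S}"
    by (rule finite_subset[of _ "Pow V"]) (use assms(1) in auto)
  ultimately have "\<exists>S\<in>{S. ?P S}. \<forall>T\<in>{S. ?P S}. S \<subseteq> T \<longrightarrow> S = T"
    by (intro finite_has_maximal) (blast+)
  then obtain S where S: "?P S" and max: "\<And>T. ?P T \<Longrightarrow> S \<subseteq> T \<Longrightarrow> S = T"
    by (simp only: mem_Collect_eq Bex_def Ball_def) metis
  have finS: "finite S" using S assms(1) finite_subset by blast
  obtain x where x: "x \<in> S" using S by (metis card.empty ex_in_conv not_numeral_le_zero)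
  show ?thesis
  proof (cases "\<exists>v\<in>V. S = V - {v}")
    case True
    then show ?thesis using S by auto
  next
    case False
    have uniform: "\<not> ({z, s} \<in> E \<and> {z, t} \<notin> E)" if z: "z \<in> V - S" "s \<in> S" "t \<in> S" for z s t
    proof
      assume *: "{z, s} \<in> E \<and> {z, t} \<notin> E"
      have "insert z S \<noteq> V" using False z by blast
      moreover have "conn E (insert z S)" "conn (- E) (insert z S)"
        using * conn_insert[of _ S s z] conn_insert[of _ S t z] S z by auto
      moreover have "4 \<le> card (insert z S)" using S finS z by simp
      ultimately have "?P (insert z S)" using S z by blast
      then show False using max[of "insert z S"] z by blast
    qed
    have "card (S - {x}) \<noteq> 0" using S x finS by (simp add: card_Diff_singleton)
    then obtain y where "y \<in> S - {x}" by (metis card.empty ex_in_conv)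
    then have "y \<in> S" "x \<noteq> y" by auto
    have "conn E (V - {x})"
      using S uniform
      by (intro conn_remove_from_module[OF assms(2) _ x \<open>y \<in> S\<close> \<open>x \<noteq> y\<close>]) metis+
    moreover have "conn (- E) (V - {x})"
      using S uniform
      by (intro conn_remove_from_module[OF assms(3) _ x \<open>y \<in> S\<close> \<open>x \<noteq> y\<close>]) (metis ComplD ComplI)+
    ultimately show ?thesis using S x by auto
  qed
qed

section \<open>Spanning trees of small maximum degree\<close>

text \<open>
  A spanning tree of maximum degree at most \<open>d\<close>, where a tree of maximum degree two must be presented
  as a Hamiltonian path: a new vertex can be inserted between consecutive vertices of a path, which adding
  leaves does not cover.
\<close>

definition spanned :: "'a set set \<Rightarrow> 'a set \<Rightarrow> nat \<Rightarrow> bool" where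
  "spanned E V d \<longleftrightarrow> 2 \<le> d \<and>
     ((\<exists>p. p \<noteq> [] \<and> set p = V \<and> distinct p \<and> walk E p) \<or>
      3 \<le> d \<and> (\<exists>F. tree V F \<and> F \<subseteq> E \<and> (\<forall>v\<in>V. degree F v \<le> d)))"

lemma spanned_pathI: "p \<noteq> [] \<Longrightarrow> set p = V \<Longrightarrow> distinct p \<Longrightarrow> walk E p \<Longrightarrow> spanned E V 2"
  unfolding spanned_def by blast

lemma spanned_mono:
  assumes *: "spanned E V d" "d \<le> d'"
  shows "spanned E V d'"
proof -
  have d': "2 \<le> d'" using * by (simp add: spanned_def)
  consider "\<exists>p. p \<noteq> [] \<and> set p = V \<and> distinct p \<and> walk E p" |
    F where "3 \<le> d" "tree V F" "F \<subseteq> E" "\<forall>v\<in>V. degree F v \<le> d"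
    using *(1) unfolding spanned_def by blast
  then show ?thesis
  proof cases
    case 1
    then show ?thesis using d' unfolding spanned_def by blast
  next
    case (2 F)
    then have "3 \<le> d'" "\<forall>v\<in>V. degree F v \<le> d'" using *(2) by (auto intro: le_trans)
    then show ?thesis using 2 d' unfolding spanned_def by blast
  qed
qed

text \<open>
  A Hamiltonian path as a tree. The bound at the head is what allows the induction to attach the next vertex there.
\<close>

lemma path_tree:
  "p \<noteq> [] \<Longrightarrow> distinct p \<Longrightarrow> walk E p \<Longrightarrow>
    \<exists>F. tree (set p) F \<and> F \<subseteq> E \<and> degree F (hd p) \<le> 1 \<and> (\<forall>v\<in>set p. degree F v \<le> 2)"
proof (induction p)
  case Nil
  then show ?case by simp
next
  case (Cons x p)
  show ?case
  proof (cases "p = []")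
    case True
    then show ?thesis using single[of x] by (intro exI[of _ "{}"]) (auto simp: degree_def)
  next
    case False
    then obtain F where F: "tree (set p) F" "F \<subseteq> E" "degree F (hd p) \<le> 1"
      "\<forall>v\<in>set p. degree F v \<le> 2" using Cons by (auto simp: successively_Cons)
    have h: "hd p \<in> set p" "x \<notin> set p" "{hd p, x} \<in> E"
      using False Cons.prems by (auto simp: successively_Cons insert_commute)
    show ?thesis
      using leaf[OF F(1) h(1,2)] F h
      by (intro exI[of _ "insert {hd p, x} F"]) (auto simp: degree_leaf[OF F(1) h(1,2)])
  qed
qed

lemma spanned_tree:
  assumes "spanned E V d"
  shows "\<exists>F. tree V F \<and> F \<subseteq> E \<and> (\<forall>v\<in>V. degree F v \<le> d)"
proof -
  have d: "2 \<le> d" using assms by (simp add: spanned_def)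
  consider p where "p \<noteq> []" "set p = V" "distinct p" "walk E p" |
    "\<exists>F. tree V F \<and> F \<subseteq> E \<and> (\<forall>v\<in>V. degree F v \<le> d)"
    using assms unfolding spanned_def by blast
  then show ?thesis
  proof cases
    case (1 p)
    then obtain F where "tree V F" "F \<subseteq> E" "\<forall>v\<in>V. degree F v \<le> 2"
      using path_tree[of p E] by blast
    then show ?thesis using d by (meson le_trans)
  qed
qed

lemma spanned_treeI:
  "3 \<le> d \<Longrightarrow> tree V F \<Longrightarrow> F \<subseteq> E \<Longrightarrow> \<forall>v\<in>V. degree F v \<le> d \<Longrightarrow> spanned E V d"
  unfolding spanned_def by auto

lemma spanned_add_leaf:
  assumes "spanned E V d" "w \<in> V" "u \<notin> V" "{w, u} \<in> E"
  shows "spanned E (insert u V) (Suc d)"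
proof -
  obtain F where F: "tree V F" "F \<subseteq> E" "\<forall>v\<in>V. degree F v \<le> d"
    using spanned_tree[OF assms(1)] by auto
  show ?thesis
  proof (rule spanned_treeI[OF _ leaf[OF F(1) assms(2,3)]])
    show "3 \<le> Suc d" using assms(1) by (auto simp: spanned_def)
    show "insert {w, u} F \<subseteq> E" using F assms by auto
    show "\<forall>v\<in>insert u V. degree (insert {w, u} F) v \<le> Suc d"
      using F(3) assms(2) by (auto simp: degree_leaf[OF F(1) assms(2,3)] le_Suc_eq)
  qed
qed

text \<open>
  If no two consecutive vertices are in \<open>N\<close> and the last one is not, each member of \<open>N\<close> is followed
  by a nonmember, so members are at most half of the list.
\<close>

lemma consecutive_or_sparse:
  "distinct p \<Longrightarrow> p \<noteq> [] \<Longrightarrow> last p \<notin> N \<Longrightarrow>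
    (\<exists>xs a b ys. p = xs @ a # b # ys \<and> a \<in> N \<and> b \<in> N) \<or> 2 * card (N \<inter> set p) \<le> length p"
proof (induction p rule: induct_list012)
  case 1
  then show ?case by simp
next
  case (2 x)
  then show ?case by simp
next
  case (3 x y q)
  have cons: "\<exists>xs a b ys. x # r = xs @ a # b # ys \<and> a \<in> N \<and> b \<in> N"
    if "\<exists>xs a b ys. r = xs @ a # b # ys \<and> a \<in> N \<and> b \<in> N" for r x
    using that by (metis append_Cons)
  consider "x \<notin> N" | "x \<in> N" "y \<in> N" | "x \<in> N" "y \<notin> N" by blast
  then show ?case
  proof cases
    case 1
    then have "N \<inter> set (x # y # q) = N \<inter> set (y # q)" by auto
    moreover have "(\<exists>xs a b ys. y # q = xs @ a # b # ys \<and> a \<in> N \<and> b \<in> N) \<or>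
      2 * card (N \<inter> set (y # q)) \<le> length (y # q)"
      using 3 by auto
    ultimately show ?thesis using cons[of "y # q" x] by auto
  next
    case 2
    then show ?thesis by (metis append_Nil)
  next
    case c3: 3
    have "N \<inter> set (x # y # q) = insert x (N \<inter> set q)" using c3 by auto
    then have card: "card (N \<inter> set (x # y # q)) = Suc (card (N \<inter> set q))"
      using "3.prems" by simp
    show ?thesis
    proof (cases "q = []")
      case True
      then show ?thesis using card by simp
    next
      case False
      then have "(\<exists>xs a b ys. q = xs @ a # b # ys \<and> a \<in> N \<and> b \<in> N) \<or>
        2 * card (N \<inter> set q) \<le> length q" using 3 by auto
      then show ?thesis using cons[of "y # q" x] cons[of q y] card by auto
    qed
  qed
qed

text \<open>
  A vertex \<open>u\<close> with neighbors in at least half of \<open>V\<close> is added without raising the degree bound. On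
  a Hamiltonian path it goes to an end or between two consecutive neighbors; in a tree it is
  attached to a neighbor of degree less than \<open>d\<close>. By \<open>consecutive_or_sparse\<close> and
  \<open>tree_few_branch_vertices\<close>, one of these is possible.
\<close>

lemma spanned_extend:
  assumes "spanned E V d" "2 \<le> card V" "u \<notin> V"
  shows "spanned E (insert u V) d \<or> 2 * card {w \<in> V. {w, u} \<in> E} < card V"
proof -
  let ?N = "{w \<in> V. {w, u} \<in> E}"
  consider p where "p \<noteq> []" "set p = V" "distinct p" "walk E p" |
    F where "3 \<le> d" "tree V F" "F \<subseteq> E" "\<forall>v\<in>V. degree F v \<le> d"
    using assms(1) unfolding spanned_def by auto
  then show ?thesis
  proof cases
    case (1 p)
    have len: "length p = card V" using 1 distinct_card by metis
    have d: "2 \<le> d" using assms(1) by (simp add: spanned_def)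
    have path: "spanned E (insert u V) d" if "set q = insert u V" "distinct q" "walk E q" for q
      by (rule spanned_mono[OF spanned_pathI d]) (use that in auto)
    consider "hd p \<in> ?N" | "last p \<in> ?N" | "hd p \<notin> ?N" "last p \<notin> ?N" by blast
    then show ?thesis
    proof cases
      case c1: 1
      then have "spanned E (insert u V) d"
        using 1 assms(3) by (intro path[of "u # p"]) (auto simp: successively_Cons insert_commute)
      then show ?thesis ..
    next
      case c2: 2
      then have "spanned E (insert u V) d"
        using 1 assms(3) by (intro path[of "p @ [u]"]) (auto simp: successively_append_iff)
      then show ?thesis ..
    next
      case c3: 3
      \<comment> \<open>As the first vertex is no neighbor of \<open>u\<close> either, dropping it gives a strict inequality.\<close>
      obtain x q where xq: "p = x # q" using 1 by (cases p) auto
      then have "q \<noteq> []" using len assms(2) by auto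
      then have "(\<exists>xs a b ys. q = xs @ a # b # ys \<and> a \<in> ?N \<and> b \<in> ?N) \<or>
          2 * card (?N \<inter> set q) \<le> length q"
        using c3 xq 1 by (intro consecutive_or_sparse) auto
      then show ?thesis
      proof
        assume "\<exists>xs a b ys. q = xs @ a # b # ys \<and> a \<in> ?N \<and> b \<in> ?N"
        then obtain xs a b ys where q: "q = xs @ a # b # ys" "a \<in> ?N" "b \<in> ?N" by blast
        have "spanned E (insert u V) d"
        proof (rule path)
          let ?q = "(x # xs) @ a # u # b # ys"
          have p: "p = (x # xs) @ a # b # ys" using xq q by simp
          show "set ?q = insert u V" using 1(2) unfolding p by auto
          show "distinct ?q" using 1(2,3) assms(3) unfolding p by auto
          have "{a, u} \<in> E" "{u, b} \<in> E" using q by (auto simp: insert_commute)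
          then show "walk E ?q" using 1(4) unfolding p
            by (simp only: successively_append_iff successively_Cons list.sel) simp
        qed
        then show ?thesis ..
      next
        assume le: "2 * card (?N \<inter> set q) \<le> length q"
        have "?N \<inter> set q = ?N" using c3 xq 1 by auto
        then show ?thesis using le len xq by simp
      qed
    qed
  next
    case (2 F)
    show ?thesis
    proof (cases "\<exists>w\<in>?N. degree F w < d")
      case True
      then obtain w where w: "w \<in> V" "{w, u} \<in> E" "degree F w < d" by auto
      have "spanned E (insert u V) d"
        by (rule spanned_treeI[OF 2(1) leaf[OF 2(2) w(1) assms(3)]])
           (use 2 w in \<open>auto simp: degree_leaf[OF 2(2) w(1) assms(3)]\<close>)
      then show ?thesis ..
    next
      case False
      then have "2 * card ?N < card V"
        using 2 by (intro tree_few_branch_vertices[OF 2(2) assms(2)]) (auto simp: not_less)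
      then show ?thesis ..
    qed
  qed
qed

text \<open>
  By \<open>tpc_le_tree\<close> this bounds the sum of the two total-proper connection numbers by
  \<open>card V + 1\<close>.
\<close>

definition cheaply_spanned :: "'a set set \<Rightarrow> 'a set \<Rightarrow> bool" where
  "cheaply_spanned E V \<longleftrightarrow> (\<exists>d d'. spanned E V d \<and> spanned (- E) V d' \<and> d + d' < card V)"

lemma cheaply_spanned_complement: "cheaply_spanned (- E) V = cheaply_spanned E V"
  unfolding cheaply_spanned_def double_complement by (metis add.commute)

text \<open>
  The neighbors of \<open>u\<close> in \<open>E\<close> and in \<open>- E\<close> together make up \<open>V\<close>, so \<open>spanned_extend\<close> keeps the
  degree bound for one of the two; attaching a leaf costs one for the other.
\<close>

lemma cheaply_spanned_insert:
  assumes "cheaply_spanned E V" "finite V" "2 \<le> card V" "u \<notin> V" "conn E (insert u V)" "conn (- E) (insert u V)"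
  shows "cheaply_spanned E (insert u V)"
proof -
  obtain d d' where d: "spanned E V d" "spanned (- E) V d'" "d + d' < card V"
    using assms(1) unfolding cheaply_spanned_def by auto
  have ne: "V \<noteq> {}" using assms(3) by auto
  obtain w where w: "w \<in> V" "{w, u} \<in> E"
    using conn_neighbor[OF assms(5,4) ne] by metis
  obtain w' where w': "w' \<in> V" "{w', u} \<in> - E"
    using conn_neighbor[OF assms(6,4) ne] by metis
  have "card {w \<in> V. {w, u} \<in> E} + card {w \<in> V. {w, u} \<in> - E} = card V"
    using assms(2) by (subst card_Un_disjoint[symmetric]) (auto intro: arg_cong[of _ _ card])
  then consider "spanned E (insert u V) d" | "spanned (- E) (insert u V) d'"
    using spanned_extend[OF d(1) assms(3,4)] spanned_extend[OF d(2) assms(3,4)] by linarith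
  then show ?thesis
  proof cases
    case 1
    then show ?thesis
      using spanned_add_leaf[OF d(2) w'(1) assms(4) w'(2)] d(3) assms(2,4)
      unfolding cheaply_spanned_def by (intro exI[of _ d] exI[of _ "Suc d'"]) auto
  next
    case 2
    then show ?thesis
      using spanned_add_leaf[OF d(1) w(1) assms(4) w(2)] d(3) assms(2,4)
      unfolding cheaply_spanned_def by (intro exI[of _ "Suc d"] exI[of _ d']) auto
  qed
qed

section \<open>Brooms\<close>

text \<open>
  The graph \<open>T(2, n - 2)\<close> induced on \<open>V\<close>: the center \<open>c\<close> is adjacent to all vertices but \<open>z\<close>, and \<open>z\<close> hangs
  from the neighbor \<open>y\<close> of \<open>c\<close>. All conditions concern distinct pairs, so the predicate applies to
  \<open>- E\<close> as well.
\<close>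

definition broom :: "'a set set \<Rightarrow> 'a set \<Rightarrow> 'a \<Rightarrow> 'a \<Rightarrow> 'a \<Rightarrow> bool" where
  "broom E V c y z \<longleftrightarrow> {c, y, z} \<subseteq> V \<and> distinct [c, y, z] \<and> {y, z} \<in> E \<and>
     (\<forall>u\<in>V - {c, z}. {c, u} \<in> E) \<and> {c, z} \<notin> E \<and> (\<forall>u\<in>V - {c, y, z}. {z, u} \<notin> E) \<and>
     (\<forall>u\<in>V - {c, z}. \<forall>v\<in>V - {c, z}. u \<noteq> v \<longrightarrow> {u, v} \<notin> E)"

lemma broom_tree:
  assumes "broom E V c y z" "finite V" "5 \<le> card V"
  shows "\<exists>F. tree V F \<and> F \<subseteq> E \<and> degree F c \<le> card V - 2 \<and> (\<forall>v\<in>V - {c}. degree F v \<le> 2)"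
proof -
  let ?L = "V - {c, y, z}"
  have b: "{c, y, z} \<subseteq> V" "distinct [c, y, z]" "{y, z} \<in> E" "\<forall>u\<in>V - {c, z}. {c, u} \<in> E"
    using assms(1) unfolding broom_def by blast+
  obtain F where F: "tree (set [c, y, z]) F" "F \<subseteq> E" "degree F (hd [c, y, z]) \<le> 1"
    "\<forall>v\<in>set [c, y, z]. degree F v \<le> 2"
    using path_tree[of "[c, y, z]" E] b by auto
  obtain F' where F': "tree (set [c, y, z] \<union> ?L) F'" "F' \<subseteq> F \<union> (\<lambda>l. {c, l}) ` ?L"
    "\<forall>v\<in>set [c, y, z] - {c}. degree F' v = degree F v" "degree F' c = degree F c + card ?L"
    "\<forall>l\<in>?L. degree F' l = 1"
    using tree_add_leaves[OF F(1), of c ?L] assms(2) by auto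
  have V: "set [c, y, z] \<union> ?L = V" using b by auto
  have cL: "card ?L = card V - 3" using b assms(2) by (simp add: card_Diff_subset)
  have "F' \<subseteq> E" using F(2) F'(2) b by auto
  moreover have "degree F' c \<le> card V - 2" using F'(4) F(3) cL assms(3) by simp
  moreover have "degree F' v \<le> 2" if "v \<in> V - {c}" for v
  proof (cases "v \<in> ?L")
    case True
    then show ?thesis using F'(5) by simp
  next
    case False
    then have "v \<in> set [c, y, z] - {c}" using that by auto
    then have "degree F' v = degree F v" "degree F v \<le> 2" using F'(3) F(4) by blast+
    then show ?thesis by simp
  qed
  ultimately show ?thesis using F'(1) V by auto
qed

lemma broom_spanned:
  assumes "broom E V c y z" "finite V" "5 \<le> card V"
  shows "spanned E V (card V - 2)"
proof -
  obtain F where F: "tree V F" "F \<subseteq> E" "degree F c \<le> card V - 2" "\<forall>v\<in>V - {c}. degree F v \<le> 2"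
    using broom_tree[OF assms] by auto
  show ?thesis
  proof (rule spanned_treeI[OF _ F(1,2)])
    show "\<forall>v\<in>V. degree F v \<le> card V - 2"
    proof
      fix v assume "v \<in> V"
      then show "degree F v \<le> card V - 2" using F(3,4) assms(3) by (cases "v = c") force+
    qed
  qed (use assms in simp)
qed

text \<open>
  In the complement of a broom, \<open>c\<close> hangs from \<open>z\<close>, the vertices other than \<open>c\<close> and \<open>z\<close> form a clique,
  and \<open>z\<close> is adjacent to all of them but \<open>y\<close>. So a Hamiltonian path starts with \<open>c, z, l\<close> for some
  \<open>l \<noteq> y\<close> and visits the clique in any order. The free choice of its end \<open>e\<close> is what later
  lets it absorb a new vertex.
\<close>

lemma broom_complement_path:
  assumes "broom E V c y z" "finite V" "5 \<le> card V" "e \<in> V - {c, z}"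
  shows "\<exists>p. hd p = c \<and> last p = e \<and> p \<noteq> [] \<and> set p = V \<and> distinct p \<and> walk (- E) p"
proof -
  have b: "{c, y, z} \<subseteq> V" "distinct [c, y, z]" "{c, z} \<notin> E" "\<forall>u\<in>V - {c, y, z}. {z, u} \<notin> E"
     "\<forall>u\<in>V - {c, z}. \<forall>v\<in>V - {c, z}. u \<noteq> v \<longrightarrow> {u, v} \<notin> E"
    using assms(1) unfolding broom_def by blast+
  have "card {c, y, z, e} < card V" using assms(3) by (simp add: card_insert_if)
  then obtain l where l: "l \<in> V" "l \<notin> {c, y, z, e}"
    using card_less_ex_outside[of "{c, y, z, e}" V] by blast
  obtain q where q: "set q = V - {c, z, l, e}" "distinct q"
    using finite_distinct_list[of "V - {c, z, l, e}"] assms(2) by auto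
  have clique: "walk (- E) r" if "set r \<subseteq> V - {c, z}" "distinct r" for r
  proof -
    have "{r ! i, r ! Suc i} \<notin> E" if i: "Suc i < length r" for i
    proof -
      have "r ! i \<noteq> r ! Suc i" using i \<open>distinct r\<close> by (simp add: nth_eq_iff_index_eq)
      moreover have "r ! i \<in> V - {c, z}" "r ! Suc i \<in> V - {c, z}"
        using \<open>set r \<subseteq> V - {c, z}\<close> i by (meson Suc_lessD nth_mem subsetD)+
      ultimately show ?thesis using b(5) by blast
    qed
    then show ?thesis by (simp add: successively_conv_nth)
  qed
  have "walk (- E) (l # q @ [e])"
    using q l assms(4) by (intro clique) auto
  then have "walk (- E) (c # z # l # q @ [e])" using b l by (auto simp: successively_Cons)
  moreover have "set (c # z # l # q @ [e]) = V" using q l assms(4) b by auto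
  moreover have "distinct (c # z # l # q @ [e])" using q l assms(4) b by auto
  ultimately show ?thesis by (intro exI[of _ "c # z # l # q @ [e]"]) auto
qed

section \<open>The dichotomy between brooms and cheap spanning trees\<close>

text \<open>
  The path absorbs \<open>u\<close> if \<open>u\<close> is adjacent to one of its ends or to both inner vertices. Otherwise \<open>u\<close> is adjacent to
  just one inner vertex, which is then the center of a broom.
\<close>

lemma P4_extend:
  assumes P: "induced_P4 E a b c d" and u: "u \<notin> {a, b, c, d}"
    and w: "w \<in> {a, b, c, d}" "{w, u} \<in> E"
  shows "spanned E (insert u {a, b, c, d}) 2 \<or> (\<exists>c' y z. broom E (insert u {a, b, c, d}) c' y z)"
proof -
  have sp: "spanned E (insert u {a, b, c, d}) 2"
    if "set p = insert u {a, b, c, d}" "distinct p" "walk E p" for p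
    using that by (intro spanned_pathI[of p]) auto
  consider "{a, u} \<in> E" | "{d, u} \<in> E" | "{b, u} \<in> E" "{c, u} \<in> E" |
    "{b, u} \<in> E" "{a, u} \<notin> E" "{c, u} \<notin> E" "{d, u} \<notin> E" |
    "{c, u} \<in> E" "{a, u} \<notin> E" "{b, u} \<notin> E" "{d, u} \<notin> E" using w by auto
  then show ?thesis
  proof cases
    case 1
    then show ?thesis using P u
      by (intro disjI1 sp[of "[u, a, b, c, d]"]) (auto simp: induced_P4_def insert_commute)
  next
    case 2
    then show ?thesis using P u
      by (intro disjI1 sp[of "[a, b, c, d, u]"]) (auto simp: induced_P4_def insert_commute)
  next
    case 3
    then show ?thesis using P u
      by (intro disjI1 sp[of "[a, b, u, c, d]"]) (auto simp: induced_P4_def insert_commute)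
  next
    case 4
    then have "broom E (insert u {a, b, c, d}) b c d" using P u
      by (auto simp: induced_P4_def broom_def insert_commute)
    then show ?thesis by blast
  next
    case 5
    then have "broom E (insert u {a, b, c, d}) c b a" using P u
      by (auto simp: induced_P4_def broom_def insert_commute)
    then show ?thesis by blast
  qed
qed

text \<open>
  If \<open>u\<close> is adjacent only to the center, the broom grows. If \<open>u\<close> is adjacent to a vertex other than \<open>c\<close> and
  nonadjacent to one other than \<open>z\<close>, the tree and the Hamiltonian path of the complement both take
  \<open>u\<close> with the old bounds \<open>card V - 2\<close> and \<open>2\<close>. In the remaining case \<open>u\<close> is adjacent to all of \<open>V\<close> but \<open>z\<close>;
  the complement then needs degree \<open>3\<close>, and this is paid for by a tree with bound
  \<open>card V - 3\<close>, in which \<open>u\<close> takes over the leaves of the broom while \<open>c\<close> lies on a path.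
\<close>

lemma broom_insert:
  assumes br: "broom E V c y z" and fin: "finite V" and card: "5 \<le> card V" and u: "u \<notin> V"
    and w: "w \<in> V" "{w, u} \<in> E" and w': "w' \<in> V" "{w', u} \<notin> E"
  shows "broom E (insert u V) c y z \<or> cheaply_spanned E (insert u V)"
proof -
  have b: "{c, y, z} \<subseteq> V" "distinct [c, y, z]" "{y, z} \<in> E" "\<forall>u\<in>V - {c, z}. {c, u} \<in> E"
    using br unfolding broom_def by blast+
  have card_u: "card (insert u V) = Suc (card V)" using fin u by simp
  consider "\<forall>x\<in>V. {x, u} \<in> E \<longrightarrow> x = c" | "\<forall>x\<in>V. {x, u} \<notin> E \<longrightarrow> x = z" |
    x x' where "x \<in> V" "{x, u} \<in> E" "x \<noteq> c" "x' \<in> V" "{x', u} \<notin> E" "x' \<noteq> z"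
    by blast
  then show ?thesis
  proof cases
    case 1
    have "{c, u} \<in> E" using 1 w by blast
    moreover have "{x, u} \<notin> E" "{u, x} \<notin> E" if "x \<in> V" "x \<noteq> c" for x
      using 1 that by (auto simp: insert_commute)
    ultimately have "broom E (insert u V) c y z"
      using br u unfolding broom_def by auto
    then show ?thesis ..
  next
    case 2
    have adj: "{u, x} \<in> E" if "x \<in> V" "x \<noteq> z" for x
      using 2 that by (metis insert_commute)
    have zu: "{z, u} \<in> - E" using 2 w' by blast
    obtain p where "p \<noteq> []" "set p = V" "distinct p" "walk (- E) p"
      using broom_complement_path[OF br fin card, of y] b by auto
    then have comp: "spanned (- E) (insert u V) 3"
      using spanned_add_leaf[OF spanned_pathI[of p V "- E"], of z u] zu b u by auto
    have cL: "card (V - {c, y, z}) = card V - 3" using b fin by (simp add: card_Diff_subset)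
    then have "card (V - {c, y, z}) \<noteq> 0" using card by simp
    then obtain l where l: "l \<in> V - {c, y, z}" by (metis card.empty ex_in_conv)
    have path: "walk E [u, l, c, y, z]" "distinct [u, l, c, y, z]"
      using b l u adj[of l] by (auto simp: insert_commute)
    let ?K = "V - {c, y, z} - {l}"
    have cK: "card ?K = card V - 4" using cL l fin by (simp add: card_Diff_singleton)
    have "spanned E (insert u V) (card V - 3)"
    \<comment> \<open>Bound \<open>2\<close> requires a Hamiltonian path, which exists because just one leaf \<open>k\<close> is left over.\<close>
    proof (cases "card V = 5")
      case True
      then obtain k where k: "?K = {k}" using cK by (auto simp: card_1_singleton_iff)
      then have V: "V = {c, y, z, l, k}" "k \<notin> {c, y, z, l}" using b l by auto
      then have "spanned E (insert u V) 2"
        using path adj[of k] u V by (intro spanned_pathI[of "[k, u, l, c, y, z]"]) (auto simp: insert_commute)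
      then show ?thesis using True by simp
    next
      case False
      obtain F where F: "tree (set [u, l, c, y, z]) F" "F \<subseteq> E" "degree F u \<le> 1"
        "\<forall>v\<in>set [u, l, c, y, z]. degree F v \<le> 2"
        using path_tree[OF _ path(2,1)] by auto
      obtain F' where F': "tree (set [u, l, c, y, z] \<union> ?K) F'"
        "F' \<subseteq> F \<union> (\<lambda>l. {u, l}) ` ?K"
        "\<forall>v\<in>set [u, l, c, y, z] - {u}. degree F' v = degree F v"
        "degree F' u = degree F u + card ?K" "\<forall>l\<in>?K. degree F' l = 1"
        using tree_add_leaves[OF F(1), of u ?K] fin u by auto
      have V: "set [u, l, c, y, z] \<union> ?K = insert u V" using b l by auto
      show ?thesis
      proof (rule spanned_treeI[OF _ F'(1)[unfolded V]])
        show "3 \<le> card V - 3" using False card by simp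
        show "F' \<subseteq> E" using F(2) F'(2) adj b by auto
        show "\<forall>v\<in>insert u V. degree F' v \<le> card V - 3"
        proof
          fix v assume "v \<in> insert u V"
          then consider "v = u" | "v \<in> set [u, l, c, y, z] - {u}" | "v \<in> ?K" using V by blast
          then show "degree F' v \<le> card V - 3"
          proof cases
            case 1
            then show ?thesis using F'(4) F(3) cK card by simp
          next
            case 2
            then have "degree F' v = degree F v" "degree F v \<le> 2" using F'(3) F(4) by blast+
            then show ?thesis using card by linarith
          next
            case 3
            then show ?thesis using F'(5) card by simp
          qed
        qed
      qed
    qed
    moreover have "card V - 3 + 3 < card (insert u V)" using card card_u by simp
    ultimately show ?thesis using comp unfolding cheaply_spanned_def by blast
  next
    case (3 x x')
    obtain F where F: "tree V F" "F \<subseteq> E" "degree F c \<le> card V - 2" "\<forall>v\<in>V - {c}. degree F v \<le> 2"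
      using broom_tree[OF br fin card] by auto
    have "spanned E (insert u V) (card V - 2)"
    proof (rule spanned_treeI[OF _ leaf[OF F(1) 3(1) u]])
      show "3 \<le> card V - 2" using card by simp
      show "insert {x, u} F \<subseteq> E" using F 3 by simp
      show "\<forall>v\<in>insert u V. degree (insert {x, u} F) v \<le> card V - 2"
      proof
        fix v assume v: "v \<in> insert u V"
        have "degree F x \<le> 2" using F(4) 3 by auto
        moreover have "degree F v \<le> 2" if "v \<noteq> u" "v \<noteq> c" using F(4) v that by auto
        ultimately show "degree (insert {x, u} F) v \<le> card V - 2"
          using F(3) card 3(3) unfolding degree_leaf[OF F(1) 3(1) u] by (cases "v = c") auto
      qed
    qed
    moreover have "spanned (- E) (insert u V) 2"
    proof (cases "x' = c")
      case True
      obtain p where "p \<noteq> []" "set p = V" "distinct p" "walk (- E) p" "hd p = c"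
        using broom_complement_path[OF br fin card, of y] b by auto
      then show ?thesis
        using True 3 u
        by (intro spanned_pathI[of "u # p"]) (auto simp: successively_Cons insert_commute)
    next
      case False
      obtain p where "p \<noteq> []" "set p = V" "distinct p" "walk (- E) p" "last p = x'"
        using broom_complement_path[OF br fin card, of x'] False 3 by auto
      then show ?thesis
        using 3 u
        by (intro spanned_pathI[of "p @ [u]"]) (auto simp: successively_append_iff)
    qed
    moreover have "card V - 2 + 2 < card (insert u V)" using card card_u by simp
    ultimately show ?thesis unfolding cheaply_spanned_def by blast
  qed
qed

lemma broom_or_cheaply_spanned:
  assumes "finite V" "conn E V" "conn (- E) V" "5 \<le> card V"
  shows "(\<exists>c y z. broom E V c y z) \<or> (\<exists>c y z. broom (- E) V c y z) \<or> cheaply_spanned E V"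
  using assms
proof (induction "card V" arbitrary: V rule: less_induct)
  case less
  obtain u where u: "u \<in> V" "conn E (V - {u})" "conn (- E) (V - {u})"
    using removable_vertex[OF less.prems] by auto
  define W where "W = V - {u}"
  have W: "V = insert u W" "u \<notin> W" "finite W" "conn E W" "conn (- E) W" "card V = Suc (card W)"
    using u less.prems(1) unfolding W_def by (auto simp: card_Suc_Diff1 simp del: card_Diff_insert)
  then have ne: "W \<noteq> {}" using less.prems(4) by auto
  obtain w where w: "w \<in> W" "{w, u} \<in> E"
    using conn_neighbor less.prems(2) W ne by metis
  obtain w' where w': "w' \<in> W" "{w', u} \<in> - E"
    using conn_neighbor less.prems(3) W ne by metis
  show ?case
  proof (cases "card W = 4")
    case True
    obtain a b c d where P4: "{a, b, c, d} \<subseteq> W" "induced_P4 E a b c d"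
      using P4_exists[OF W(3,4,5)] True by auto
    then have "card {a, b, c, d} = 4" by (auto simp: induced_P4_def)
    then have eq: "W = {a, b, c, d}" using P4(1) W(3) True card_subset_eq by metis
    then have eq': "W = {b, d, a, c}" by auto
    have "spanned E V 2 \<or> (\<exists>c y z. broom E V c y z)"
      using P4_extend[OF P4(2), folded eq] W(1,2) w by auto
    moreover have "spanned (- E) V 2 \<or> (\<exists>c y z. broom (- E) V c y z)"
      using P4_extend[OF induced_P4_complement[OF P4(2)], folded eq'] W(1,2) w' by auto
    moreover have "cheaply_spanned E V" if "spanned E V 2" "spanned (- E) V 2"
      using that less.prems(4) unfolding cheaply_spanned_def by (intro exI[of _ 2]) auto
    ultimately show ?thesis by blast
  next
    case False
    then have card: "5 \<le> card W" using less.prems(4) W by linarith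
    have "card W < card V" using W by simp
    then consider c y z where "broom E W c y z" | c y z where "broom (- E) W c y z" | "cheaply_spanned E W"
      using less.hyps[of W] W card by blast
    then show ?thesis
    proof cases
      case 1
      then show ?thesis using broom_insert[OF 1 W(3) card W(2) w w'(1)] w'(2) W(1) by auto
    next
      case 2
      then show ?thesis
        using broom_insert[OF 2 W(3) card W(2) w' w(1)] w(2) W(1) cheaply_spanned_complement[of E V] by auto
    next
      case 3
      then show ?thesis
        using cheaply_spanned_insert[OF 3 W(3) _ W(2)] less.prems W card by auto
    qed
  qed
qed

section \<open>The two sums of total-proper connection numbers\<close>

lemma walk_crosses:
  "walk E p \<Longrightarrow> p \<noteq> [] \<Longrightarrow> hd p \<in> A \<Longrightarrow> last p \<notin> A \<Longrightarrow>
    \<exists>a\<in>set p \<inter> A. \<exists>b\<in>set p - A. {a, b} \<in> E"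
proof (induction p rule: induct_list012)
  case (3 x y p)
  then show ?case by (cases "y \<in> A") auto
qed auto

lemma connected_graph_conn:
  assumes "connected_graph G"
  shows "conn (edges G) (verts G)"
proof (rule connI)
  fix A assume A: "A \<noteq> {}" "A \<subset> verts G"
  then obtain a b where ab: "a \<in> A" "a \<in> verts G" "b \<in> verts G" "b \<notin> A" by blast
  then obtain p where p: "path_between G a p b"
    using assms unfolding connected_graph_def by blast
  then have "walk (edges G) p" "p \<noteq> []" "hd p \<in> A" "last p \<notin> A" "set p \<subseteq> verts G"
    using ab unfolding path_between_def successively_conv_nth by auto
  then show "\<exists>a\<in>A. \<exists>b\<in>verts G - A. {a, b} \<in> edges G"
    using walk_crosses[of "edges G" p A] by blast
qed

lemma tpc_le_spanned:
  assumes "spanned E (verts G) d" "{e \<in> E. e \<subseteq> verts G \<and> card e = 2} \<subseteq> edges G"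
  shows "tpc G \<le> d + 1"
proof -
  obtain F where F: "tree (verts G) F" "F \<subseteq> E" "\<forall>v\<in>verts G. degree F v \<le> d"
    using spanned_tree[OF assms(1)] by auto
  then have "F \<subseteq> edges G" using tree_edges[OF F(1)] assms(2) by blast
  then show ?thesis
    using F assms(1) tpc_le_tree[OF F(1)] unfolding spanned_def by blast
qed

lemma edges_complement:
  "edges (complement G) = {e. e \<subseteq> verts G \<and> card e = 2 \<and> e \<notin> edges G}"
  "verts (complement G) = verts G"
  by (simp_all add: complement_def)

lemma simple_complement: "simple_graph G \<Longrightarrow> simple_graph (complement G)"
  by (simp add: simple_graph_def complement_def)

lemma complement_complement: "simple_graph G \<Longrightarrow> complement (complement G) = G"
  by (cases G) (auto simp: simple_graph_def complement_def)

lemma finite_colors: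
  assumes "simple_graph G"
  shows "finite (cv ` verts G \<union> ce ` edges G)"
proof -
  have "edges G \<subseteq> Pow (verts G)" using assms by (auto simp: simple_graph_def)
  then have "finite (edges G)" using assms by (auto simp: simple_graph_def intro: finite_subset)
  then show ?thesis using assms by (auto simp: simple_graph_def)
qed

text \<open>
  The leaf \<open>a\<close> is only adjacent to \<open>c\<close>, so a path from \<open>a\<close> to another neighbor \<open>b\<close> of \<open>c\<close> starts with \<open>a, c\<close>.
  After that it must go straight to \<open>b\<close>: a detour could only run through \<open>y\<close> to \<open>z\<close>, where it ends.
\<close>

lemma broom_colors:
  assumes br: "broom (edges G) (verts G) c y z"
    and col: "total_proper_connected G cv ce"
    and a: "a \<in> verts G - {c, y, z}" and b: "b \<in> verts G - {c, z}" and ab: "a \<noteq> b"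
  shows "ce {c, a} \<noteq> ce {c, b} \<and> cv c \<noteq> ce {c, a} \<and> cv c \<noteq> ce {c, b}"
proof -
  let ?E = "edges G"
  have br': "{c, y, z} \<subseteq> verts G" "distinct [c, y, z]" "{c, z} \<notin> ?E"
    "\<And>u. u \<in> verts G - {c, y, z} \<Longrightarrow> {z, u} \<notin> ?E"
    "\<And>u v. u \<in> verts G - {c, z} \<Longrightarrow> v \<in> verts G - {c, z} \<Longrightarrow> u \<noteq> v \<Longrightarrow> {u, v} \<notin> ?E"
    using br unfolding broom_def by blast+
  obtain p where p: "path_between G a p b" "total_proper_path cv ce p"
    using col a b ab unfolding total_proper_connected_def by (meson DiffD1)
  then have path: "p \<noteq> []" "hd p = a" "last p = b" "set p \<subseteq> verts G" "distinct p" "walk ?E p"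
    unfolding path_between_def successively_conv_nth by auto
  obtain x r where x: "p = a # x # r"
    using path(1-3) ab by (metis hd_Cons_tl last_ConsL)
  have "x = c"
    using path(4-6) a br'(4)[of a] br'(5)[of a x] unfolding x by (auto simp: insert_commute)
  then obtain v q where v: "p = a # c # v # q"
    using path(3) x b by (cases r) auto
  have vz: "v \<in> verts G - {c, z}"
    using path(4-6) br'(3) unfolding v by auto
  have "v = b"
  proof (rule ccontr)
    assume "v \<noteq> b"
    then obtain s t where s: "p = a # c # v # s # t"
      using path(3) v by (cases q) auto
    have "s = z"
      using path(4-6) vz br'(5)[of v s] unfolding s by auto
    moreover have "v = y"
      using path(4-6) vz br'(4)[of v] \<open>s = z\<close> unfolding s by (auto simp: insert_commute)
    moreover obtain k l where k: "t = k # l"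
      using path(3) s b \<open>s = z\<close> by (cases t) auto
    ultimately show False
      using path(4-6) br'(4)[of k] unfolding s k by auto
  qed
  then have p3: "p = a # c # b # q" using v by simp
  note tp = p(2)[unfolded total_proper_path_def]
  have "ce {a, c} \<noteq> ce {c, b}"
    using conjunct1[OF tp, rule_format, of 0] by (simp add: p3)
  moreover have "cv c \<noteq> ce {a, c}" "cv c \<noteq> ce {c, b}"
    using conjunct2[OF conjunct2[OF tp], rule_format, of 1] by (simp_all add: p3)
  ultimately show ?thesis by (simp add: insert_commute)
qed

lemma broom_tpc_ge:
  assumes br: "broom (edges G) (verts G) c y z" and G: "simple_graph G" and card: "5 \<le> card (verts G)"
  shows "card (verts G) - 1 \<le> tpc G"
proof -
  let ?V = "verts G" and ?M = "verts G - {c, z}"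
  have fin: "finite ?V" using G by (simp add: simple_graph_def)
  have b: "{c, y, z} \<subseteq> ?V" "distinct [c, y, z]" "\<forall>u\<in>?M. {c, u} \<in> edges G"
    using br unfolding broom_def by blast+
  obtain F where F: "tree ?V F" "F \<subseteq> edges G"
    using broom_tree[OF br fin card] by auto
  show ?thesis
  proof (rule tpc_geI[OF F])
    fix cv ce assume col: "total_proper_connected G cv ce"
    \<comment> \<open>At most one of \<open>m\<close>, \<open>m'\<close> is \<open>y\<close>; the other one is a leaf.\<close>
    have two: "ce {c, m} \<noteq> ce {c, m'} \<and> cv c \<noteq> ce {c, m}" if "m \<in> ?M" "m' \<in> ?M" "m \<noteq> m'" for m m'
    proof (cases "m = y")
      case True
      then have "m' \<in> ?V - {c, y, z}" using that by auto
      then show ?thesis using broom_colors[OF br col, of m' m] that by auto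
    next
      case False
      then have "m \<in> ?V - {c, y, z}" using that by auto
      then show ?thesis using broom_colors[OF br col, of m m'] that by auto
    qed
    have cM: "card ?M = card ?V - 2" using b fin by (simp add: card_Diff_subset)
    have "inj_on (\<lambda>m. ce {c, m}) ?M" using two by (meson inj_onI)
    then have "card ((\<lambda>m. ce {c, m}) ` ?M) = card ?V - 2" using cM by (simp add: card_image)
    moreover have "cv c \<notin> (\<lambda>m. ce {c, m}) ` ?M"
    proof
      assume "cv c \<in> (\<lambda>m. ce {c, m}) ` ?M"
      then obtain m where m: "m \<in> ?M" "cv c = ce {c, m}" by auto
      have "card {m} < card ?M" using cM card by simp
      then obtain m' where "m' \<in> ?M" "m \<noteq> m'"
        using card_less_ex_outside[of "{m}" ?M] by auto
      then show False using two m by blast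
    qed
    ultimately have "card ?V - 1 = card (insert (cv c) ((\<lambda>m. ce {c, m}) ` ?M))"
      using fin card by simp
    also have "\<dots> \<le> card (cv ` ?V \<union> ce ` edges G)"
      using b by (intro card_mono finite_colors[OF G]) auto
    finally show "card ?V - 1 \<le> card (cv ` ?V \<union> ce ` edges G)" .
  qed
qed

lemma broom_tpc_sum:
  assumes br: "broom (edges G) (verts G) c y z" and G: "simple_graph G" and card: "5 \<le> card (verts G)"
  shows "tpc G + tpc (complement G) = card (verts G) + 2"
proof -
  have fin: "finite (verts G)" using G by (simp add: simple_graph_def)
  have b: "{c, y, z} \<subseteq> verts G" "distinct [c, y, z]" "{y, z} \<in> edges G"
    using br unfolding broom_def by blast+
  have "tpc G \<le> card (verts G) - 2 + 1"
    by (rule tpc_le_spanned[OF broom_spanned[OF br fin card]]) auto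
  moreover have "card (verts G) - 1 \<le> tpc G" by (rule broom_tpc_ge[OF br G card])
  moreover have "tpc (complement G) = 3"
  proof (rule antisym)
    obtain p where p: "p \<noteq> []" "set p = verts G" "distinct p" "walk (- edges G) p"
      using broom_complement_path[OF br fin card, of y] b by auto
    then have sp: "spanned (- edges G) (verts (complement G)) 2"
      by (simp add: edges_complement spanned_pathI)
    then show "tpc (complement G) \<le> 3"
      using tpc_le_spanned[OF sp] by (auto simp: edges_complement)
    obtain F where F: "tree (verts (complement G)) F" "F \<subseteq> - edges G"
      using spanned_tree[OF sp] by auto
    have "F \<subseteq> edges (complement G)"
      using F(2) tree_edges[OF F(1)] by (auto simp: edges_complement)
    then show "3 \<le> tpc (complement G)"
      using tpc_noncomplete[OF simple_complement[OF G] F(1), of y z] b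
      by (auto simp: edges_complement)
  qed
  ultimately show ?thesis using card by linarith
qed

lemma cheaply_spanned_tpc_sum:
  assumes "cheaply_spanned (edges G) (verts G)"
  shows "tpc G + tpc (complement G) \<le> card (verts G) + 1"
proof -
  obtain d d' where d: "spanned (edges G) (verts G) d" "spanned (- edges G) (verts G) d'"
    "d + d' < card (verts G)" using assms unfolding cheaply_spanned_def by auto
  have "tpc G \<le> d + 1" by (rule tpc_le_spanned[OF d(1)]) auto
  moreover have "tpc (complement G) \<le> d' + 1"
    using d(2) by (intro tpc_le_spanned[of "- edges G"]) (auto simp: edges_complement)
  ultimately show ?thesis using d(3) by linarith
qed

section \<open>Brooms are the double stars with parts 2 and n - 2\<close>

lemma broom_cong:
  assumes "\<And>u v. u \<in> V \<Longrightarrow> v \<in> V \<Longrightarrow> u \<noteq> v \<Longrightarrow> {u, v} \<in> E \<longleftrightarrow> {u, v} \<in> E'"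
  shows "broom E V c y z \<longleftrightarrow> broom E' V c y z"
  using assms unfolding broom_def by auto

text \<open>
  The adjacency relation of a broom is determined by \<open>c\<close>, \<open>y\<close> and \<open>z\<close>; hence two brooms of the same order
  are isomorphic.
\<close>

lemma broom_edge_iff:
  assumes "broom (edges G) (verts G) c y z" "simple_graph G" "u \<in> verts G" "v \<in> verts G"
  shows "{u, v} \<in> edges G \<longleftrightarrow>
    (u = c \<and> v \<notin> {c, z}) \<or> (v = c \<and> u \<notin> {c, z}) \<or> (u = y \<and> v = z) \<or> (u = z \<and> v = y)"
proof (cases "u = v")
  case True
  then have "{u, v} \<notin> edges G" using assms(2) by (auto simp: simple_graph_def)
  then show ?thesis using True assms(1) by (auto simp: broom_def)
next
  case False
  have b: "distinct [c, y, z]" "{y, z} \<in> edges G" "{z, y} \<in> edges G" "{c, z} \<notin> edges G"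
    "{z, c} \<notin> edges G"
    using assms(1) unfolding broom_def by (simp_all add: insert_commute[of z])
  have bc: "{c, x} \<in> edges G \<and> {x, c} \<in> edges G" if "x \<in> verts G" "x \<noteq> c" "x \<noteq> z" for x
    using assms(1) that unfolding broom_def by (simp add: insert_commute[of x c])
  have bz: "{z, x} \<notin> edges G \<and> {x, z} \<notin> edges G"
    if "x \<in> verts G" "x \<noteq> c" "x \<noteq> y" "x \<noteq> z" for x
    using assms(1) that unfolding broom_def by (simp add: insert_commute[of x z])
  have bo: "{u, v} \<notin> edges G" if "u \<noteq> c" "u \<noteq> z" "v \<noteq> c" "v \<noteq> z"
    using assms(1,3,4) that False unfolding broom_def by simp
  consider "u = c" | "v = c" | "u = z" "v \<noteq> c" | "v = z" "u \<noteq> c" |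
    "u \<noteq> c" "u \<noteq> z" "v \<noteq> c" "v \<noteq> z" by blast
  then show ?thesis
  proof cases
    case 1
    then show ?thesis using b bc[of v] False assms(4) by (cases "v = z") auto
  next
    case 2
    then show ?thesis using b bc[of u] False assms(3) by (cases "u = z") auto
  next
    case 3
    then show ?thesis using b bz[of v] False assms(4) by (cases "v = y") auto
  next
    case 4
    then show ?thesis using b bz[of u] False assms(3) by (cases "u = y") auto
  next
    case 5
    then show ?thesis using bo by simp
  qed
qed

lemma isomorphic_broom:
  assumes "isomorphic G H" "broom (edges H) (verts H) c y z"
  shows "\<exists>c y z. broom (edges G) (verts G) c y z"
proof -
  obtain f where f: "bij_betw f (verts G) (verts H)"
    "\<And>u v. u \<in> verts G \<Longrightarrow> v \<in> verts G \<Longrightarrow> {u, v} \<in> edges G \<longleftrightarrow> {f u, f v} \<in> edges H"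
    using assms(1) unfolding isomorphic_def by blast
  have b: "c \<in> verts H" "y \<in> verts H" "z \<in> verts H"
    using assms(2) unfolding broom_def by auto
  have surj: "\<exists>x\<in>verts G. f x = v" if "v \<in> verts H" for v
    using bij_betw_imp_surj_on[OF f(1)] that by (metis imageE)
  obtain c' y' z' where c': "c' \<in> verts G" "f c' = c" "y' \<in> verts G" "f y' = y"
    "z' \<in> verts G" "f z' = z"
    using surj[OF b(1)] surj[OF b(2)] surj[OF b(3)] by blast
  have img: "f u \<in> verts H" if "u \<in> verts G" for u using f(1) that by (rule bij_betwE[rule_format])
  have inj: "f u = f v \<longleftrightarrow> u = v" if "u \<in> verts G" "v \<in> verts G" for u v
    using f(1) that by (metis bij_betw_imp_inj_on inj_onD)
  have f3: "f u = c \<longleftrightarrow> u = c'" "f u = y \<longleftrightarrow> u = y'" "f u = z \<longleftrightarrow> u = z'" if "u \<in> verts G" for u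
    using inj[of u c'] inj[of u y'] inj[of u z'] c' that by auto
  have bH: "distinct [c, y, z]" "{y, z} \<in> edges H" "{c, z} \<notin> edges H"
    "\<And>u. u \<in> verts H - {c, z} \<Longrightarrow> {c, u} \<in> edges H"
    "\<And>u. u \<in> verts H - {c, y, z} \<Longrightarrow> {z, u} \<notin> edges H"
    "\<And>u v. u \<in> verts H - {c, z} \<Longrightarrow> v \<in> verts H - {c, z} \<Longrightarrow> u \<noteq> v \<Longrightarrow> {u, v} \<notin> edges H"
    using assms(2) unfolding broom_def by blast+
  have "broom (edges G) (verts G) c' y' z'"
    unfolding broom_def
  proof (intro conjI ballI impI)
    show "{c', y', z'} \<subseteq> verts G" using c' by simp
    show "distinct [c', y', z']" using bH(1) c' by auto
    show "{y', z'} \<in> edges G" "{c', z'} \<notin> edges G" using bH(2,3) c' by (simp_all add: f(2))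
    show "{c', u} \<in> edges G" if "u \<in> verts G - {c', z'}" for u
      using bH(4)[of "f u"] that img c'(1,5) by (simp add: f(2) f3 c'(2,6))
    show "{z', u} \<notin> edges G" if "u \<in> verts G - {c', y', z'}" for u
      using bH(5)[of "f u"] that img c'(1,5) by (simp add: f(2) f3 c'(2,6))
    show "{u, v} \<notin> edges G" if "u \<in> verts G - {c', z'}" "v \<in> verts G - {c', z'}" "u \<noteq> v" for u v
      using bH(6)[of "f u" "f v"] that img inj[of u v] by (simp add: f(2) f3)
  qed
  then show ?thesis by blast
qed

lemma brooms_isomorphic:
  assumes G: "broom (edges G) (verts G) c y z" "simple_graph G"
    and H: "broom (edges H) (verts H) c' y' z'" "simple_graph H"
    and card: "card (verts G) = card (verts H)"
  shows "isomorphic G H"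
proof -
  have fin: "finite (verts G)" "finite (verts H)" using G H by (auto simp: simple_graph_def)
  have bG: "{c, y, z} \<subseteq> verts G" "distinct [c, y, z]" using G unfolding broom_def by blast+
  have bH: "{c', y', z'} \<subseteq> verts H" "distinct [c', y', z']" using H unfolding broom_def by blast+
  have "card (verts G - {c, y, z}) = card (verts H - {c', y', z'})"
    using bG bH fin card by (simp add: card_Diff_subset)
  then obtain g where g: "bij_betw g (verts G - {c, y, z}) (verts H - {c', y', z'})"
    using fin by (metis finite_Diff finite_same_card_bij)
  define f where "f = g(c := c', y := y', z := z')"
  have "bij_betw f (verts G - {c, y, z} \<union> {c, y, z}) (verts H - {c', y', z'} \<union> {c', y', z'})"
  proof (rule bij_betw_combine)
    show "bij_betw f (verts G - {c, y, z}) (verts H - {c', y', z'})"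
      using g by (rule bij_betw_cong[THEN iffD1, rotated]) (auto simp: f_def)
    show "bij_betw f {c, y, z} {c', y', z'}"
      using bG bH by (auto simp: bij_betw_def f_def)
  qed auto
  then have bij: "bij_betw f (verts G) (verts H)"
    using Diff_partition[OF bG(1)] Diff_partition[OF bH(1)] by (metis Un_commute)
  have val: "f c = c'" "f y = y'" "f z = z'" using bG by (auto simp: f_def)
  have img: "f u \<in> verts H" if "u \<in> verts G" for u using bij that by (rule bij_betwE[rule_format])
  have inj: "f u = f v \<longleftrightarrow> u = v" if "u \<in> verts G" "v \<in> verts G" for u v
    using bij that by (metis bij_betw_imp_inj_on inj_onD)
  have f3: "f u = c' \<longleftrightarrow> u = c" "f u = y' \<longleftrightarrow> u = y" "f u = z' \<longleftrightarrow> u = z" if "u \<in> verts G" for u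
    using inj[of u c] inj[of u y] inj[of u z] that bG val by auto
  have "{u, v} \<in> edges G \<longleftrightarrow> {f u, f v} \<in> edges H" if "u \<in> verts G" "v \<in> verts G" for u v
    using that by (simp add: broom_edge_iff[OF G] broom_edge_iff[OF H] img f3)
  then show ?thesis using bij unfolding isomorphic_def by blast
qed

lemma verts_double_star: "verts (double_star a b) = Inl ` {..<a} \<union> Inr ` {..<b}"
  by (simp add: double_star_def star_def)

lemma card_double_star: "card (verts (double_star a b)) = a + b"
  unfolding verts_double_star
  by (subst card_Un_disjoint) (auto simp: card_image)

lemma edges_double_star:
  "edges (double_star a b) =
     {{Inl 0, Inl i} | i. 0 < i \<and> i < a} \<union> {{Inr 0, Inr i} | i. 0 < i \<and> i < b} \<union> {{Inl 0, Inr 0}}"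
proof -
  have *: "(\<lambda>e. h ` e) ` {{0, i} | i. 0 < i \<and> i < k} = {{h 0, h i} | i. 0 < i \<and> i < k}"
    for h :: "nat \<Rightarrow> nat + nat" and k :: nat
    by (auto simp: image_iff) (metis image_empty image_insert)
  show ?thesis by (simp add: double_star_def star_def *)
qed

lemma simple_double_star: "0 < a \<Longrightarrow> 0 < b \<Longrightarrow> simple_graph (double_star a b)"
  unfolding simple_graph_def edges_double_star verts_double_star by auto

lemma broom_double_star:
  assumes "0 < k"
  shows "broom (edges (double_star 2 k)) (verts (double_star 2 k)) (Inr 0) (Inl 0) (Inl 1)"
  using assms unfolding broom_def edges_double_star verts_double_star
  by (auto simp: doubleton_eq_iff less_2_cases_iff lessThan_Suc numeral_2_eq_2)

lemma isomorphic_double_star_iff: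
  assumes "simple_graph G" "3 \<le> card (verts G)"
  shows "isomorphic G (double_star 2 (card (verts G) - 2)) \<longleftrightarrow>
    (\<exists>c y z. broom (edges G) (verts G) c y z)"
proof -
  let ?D = "double_star 2 (card (verts G) - 2)"
  have D: "broom (edges ?D) (verts ?D) (Inr 0) (Inl 0) (Inl 1)" "simple_graph ?D"
    "card (verts G) = card (verts ?D)"
    using assms(2) broom_double_star[of "card (verts G) - 2"]
      simple_double_star[of 2 "card (verts G) - 2"] by (simp_all add: card_double_star)
  then show ?thesis
    using isomorphic_broom[OF _ D(1)] brooms_isomorphic[OF _ assms(1) D(1,2,3)] by blast
qed

section \<open>The theorem\<close>

theorem theorem5:
  fixes G :: "'a ugraph" and n :: nat
  assumes "simple_graph G"
    and "card (verts G) = n"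
    and "n \<ge> 5"
    and "connected_graph G"
    and "connected_graph (complement G)"
  shows "tpc G + tpc (complement G) \<le> n + 2 \<and>
         (tpc G + tpc (complement G) = n + 2 \<longleftrightarrow>
            isomorphic G (double_star 2 (n - 2)) \<or>
            isomorphic (complement G) (double_star 2 (n - 2)))"
proof -
  let ?V = "verts G" and ?C = "complement G"
  let ?B = "\<lambda>H. \<exists>c y z. broom (edges H) (verts H) c y z"
  have fin: "finite ?V" and card: "5 \<le> card ?V" using assms by (auto simp: simple_graph_def)
  have iso: "isomorphic G (double_star 2 (n - 2)) \<longleftrightarrow> ?B G"
    "isomorphic ?C (double_star 2 (n - 2)) \<longleftrightarrow> ?B ?C"
    using isomorphic_double_star_iff[OF assms(1)]
      isomorphic_double_star_iff[OF simple_complement[OF assms(1)]] card assms(2)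
    by (simp_all add: edges_complement)
  have conn: "conn (edges G) ?V" "conn (- edges G) ?V"
    using connected_graph_conn[OF assms(4)] connected_graph_conn[OF assms(5)]
      conn_mono[of "edges ?C" ?V "- edges G"]
    by (auto simp: edges_complement)
  have co: "broom (edges ?C) (verts ?C) c y z \<longleftrightarrow> broom (- edges G) ?V c y z" for c y z
    unfolding edges_complement(2) by (rule broom_cong) (auto simp: edges_complement)
  have sum: "tpc G + tpc ?C = n + 2" if "?B G \<or> ?B ?C"
    using that
  proof
    assume "?B G"
    then obtain c y z where "broom (edges G) ?V c y z" by blast
    then show ?thesis using broom_tpc_sum[of G c y z] assms(1,2) card by simp
  next
    assume "?B ?C"
    then have "tpc ?C + tpc (complement ?C) = n + 2"
      using broom_tpc_sum[OF _ simple_complement[OF assms(1)]] assms(2) card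
      by (auto simp: edges_complement)
    then show ?thesis by (simp add: complement_complement[OF assms(1)])
  qed
  moreover have "tpc G + tpc ?C \<le> n + 1" if "\<not> (?B G \<or> ?B ?C)"
    using broom_or_cheaply_spanned[OF fin conn card] that co cheaply_spanned_tpc_sum[of G] assms(2) by blast
  ultimately show ?thesis unfolding iso by (metis Suc_eq_plus1 add_2_eq_Suc' le_SucI le_refl not_less_eq_eq)
qed

end
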